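(* Let $J>0$, $h\ne0$, $\rho>0$ and $\varepsilon\in\mathcal{E}_{h,\rho}$. Define $m=-\frac hJ+\mathrm{sgn}(h)\sqrt{\frac{h^2}{J^2}-\frac{2\varepsilon}J}$, $\mu=-\frac m{\rho-m^2}$ and $\eta=\frac1{2(\rho-m^2)}$. Let $I\subset\Lambda$ be an index set of fixed size, and let $f:\mathbb{R}^{|I|}\to\mathbb{R}$ be either a bounded $1$-Lipschitz function with respect to $\|\cdot\|_2$ or a finite product of coordinates of finite order. Then \[ \langle f\circ P_I\rangle_{\mathrm{MC}}^{\varepsilon,\rho;N}=\langle f\circ P_I\rangle_{\mathrm{GC}}^{\mu,\eta;N}+O(N^{-1/2}). \]
   Context: Mean-field spherical model: $\Lambda$ finite lattice, $N=|\Lambda|$, $\phi\in\mathbb{R}^N$, $H[\phi]=-\frac J{2N}(\sum_x\phi_x)^2-h\sum_x\phi_x$; $P_I$ restricts to sites in $I$. For $|m|<\sqrt\rho$, $\mu_{\mathrm{MC}}^{m,\rho;N}$ is the normalized uniform surface measure on $\{\sum\phi_x=mN,\ \sum\phi_x^2=\rho N\}$, $Z_{\mathrm{MC}}(m,\rho;N)=(\rho-m^2)^{(N-3)/2}$. For $\varepsilon\le\frac{h^2}{2J}$, $m_\pm=-\frac hJ\pm\sqrt{\frac{h^2}{J^2}-\frac{2\varepsilon}J}$. Fixed energy ensemble: if $\varepsilon<\frac{h^2}{2J}$ and $m_\pm^2<\rho$, $\langle f\rangle_{\mathrm{MC}}^{\varepsilon,\rho;N}=\sum_\pm\frac{Z_{\mathrm{MC}}(m_\pm,\rho;N)}{Z_{\mathrm{MC}}(m_+,\rho;N)+Z_{\mathrm{MC}}(m_-,\rho;N)}\langle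 f\rangle_{\mathrm{MC}}^{m_\pm,\rho;N}$; if $\varepsilon<\frac{h^2}{2J}$ and $\min(m_\pm^2)<\rho\le\max(m_\pm^2)$, it is $\langle f\rangle_{\mathrm{MC}}^{m',\rho;N}$ with $m'$ the one of $m_\pm$ of smaller absolute value; if $\varepsilon=\frac{h^2}{2J}$ and $\rho>h^2/J^2$, it is $\langle f\rangle_{\mathrm{MC}}^{-h/J,\rho;N}$. $\mathcal{E}_{h,\rho}=\{\varepsilon\le\frac{h^2}{2J}:|\frac{|h|}J-\sqrt{\frac{h^2}{J^2}-\frac{2\varepsilon}J}|<\sqrt\rho\}$. $\mu_{\mathrm{GC}}^{\mu,\eta;N}$ has density on $\mathbb{R}^N$ proportional to $e^{-\mu\sum_x\phi_x-\eta\sum_x\phi_x^2}$. *)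

theory Defs
  imports "HOL-Analysis.Analysis" "HOL-Probability.Probability" "HOL-Library.Landau_Symbols"
begin

text \<open>Lattice \<Lambda> = {..<N}; configurations phi are (extensional) functions nat => real,
  i.e. points of the product measure space PiM {..<N} (\<lambda>_. lborel) = Lebesgue measure on R^N.\<close>

abbreviation leb :: "nat \<Rightarrow> (nat \<Rightarrow> real) measure" where
  "leb N \<equiv> PiM {..<N} (\<lambda>_. lborel)"

definition vmean :: "nat \<Rightarrow> (nat \<Rightarrow> real) \<Rightarrow> real" where
  "vmean N x = (\<Sum>i<N. x i) / real N"

definition vdev :: "nat \<Rightarrow> (nat \<Rightarrow> real) \<Rightarrow> (nat \<Rightarrow> real)" where
  "vdev N x = (\<lambda>i\<in>{..<N}. x i - vmean N x)"

definition vnorm :: "nat \<Rightarrow> (nat \<Rightarrow> real) \<Rightarrow> real" where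
  "vnorm N z = sqrt (\<Sum>i<N. (z i)^2)"

text \<open>The microcanonical surface {sum phi = m N, sum phi^2 = rho N} is the sphere
  of radius sqrt(N (rho - m^2)) centred at (m,...,m) in the hyperplane sum phi = m N.\<close>

definition mc_radius :: "real \<Rightarrow> real \<Rightarrow> nat \<Rightarrow> real" where
  "mc_radius m \<rho> N = sqrt (real N * (\<rho> - m^2))"

definition mc_proj :: "real \<Rightarrow> real \<Rightarrow> nat \<Rightarrow> (nat \<Rightarrow> real) \<Rightarrow> (nat \<Rightarrow> real)" where
  "mc_proj m \<rho> N x = (\<lambda>i\<in>{..<N}. m + mc_radius m \<rho> N * vdev N x i / vnorm N (vdev N x))"

text \<open>cone over the surface (within the hyperplane direction), thickened by a unit
  segment in the orthogonal direction (1,...,1)\<close>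
definition mc_cyl :: "real \<Rightarrow> real \<Rightarrow> nat \<Rightarrow> (nat \<Rightarrow> real) set" where
  "mc_cyl m \<rho> N = {x \<in> {..<N} \<rightarrow>\<^sub>E UNIV. vnorm N (vdev N x) \<le> mc_radius m \<rho> N
                       \<and> 0 \<le> vmean N x \<and> vmean N x \<le> 1}"

text \<open>Expectation under the normalized uniform surface measure mu_MC^{m,rho;N}
  (realised as the normalized cone measure: mass of a surface set A is the relative volume of
  the cone over A).\<close>
definition mc_expect :: "real \<Rightarrow> real \<Rightarrow> nat \<Rightarrow> ((nat \<Rightarrow> real) \<Rightarrow> real) \<Rightarrow> real" where
  "mc_expect m \<rho> N g =
     (\<integral>x. indicator (mc_cyl m \<rho> N) x * g (mc_proj m \<rho> N x) \<partial>leb N) / measure (leb N) (mc_cyl m \<rho> N)"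

definition mc_Z :: "real \<Rightarrow> real \<Rightarrow> nat \<Rightarrow> real" where
  "mc_Z m \<rho> N = (\<rho> - m^2) powr ((real N - 3) / 2)"

definition m_plus :: "real \<Rightarrow> real \<Rightarrow> real \<Rightarrow> real" where
  "m_plus J h \<epsilon> = - h / J + sqrt (h^2 / J^2 - 2 * \<epsilon> / J)"

definition m_minus :: "real \<Rightarrow> real \<Rightarrow> real \<Rightarrow> real" where
  "m_minus J h \<epsilon> = - h / J - sqrt (h^2 / J^2 - 2 * \<epsilon> / J)"

definition mc_energy :: "real \<Rightarrow> real \<Rightarrow> real \<Rightarrow> real \<Rightarrow> nat \<Rightarrow> ((nat \<Rightarrow> real) \<Rightarrow> real) \<Rightarrow> real" where
  "mc_energy J h \<epsilon> \<rho> N g =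
    (let mp = m_plus J h \<epsilon>; mm = m_minus J h \<epsilon> in
     if \<epsilon> < h^2 / (2*J) \<and> mp^2 < \<rho> \<and> mm^2 < \<rho> then
       (mc_Z mp \<rho> N * mc_expect mp \<rho> N g + mc_Z mm \<rho> N * mc_expect mm \<rho> N g)
         / (mc_Z mp \<rho> N + mc_Z mm \<rho> N)
     else if \<epsilon> < h^2 / (2*J) \<and> min (mp^2) (mm^2) < \<rho> \<and> \<rho> \<le> max (mp^2) (mm^2) then
       mc_expect (if \<bar>mp\<bar> \<le> \<bar>mm\<bar> then mp else mm) \<rho> N g
     else if \<epsilon> = h^2 / (2*J) \<and> \<rho> > h^2 / J^2 then
       mc_expect (- h / J) \<rho> N g
     else undefined)"

definition gc_expect :: "real \<Rightarrow> real \<Rightarrow> nat \<Rightarrow> ((nat \<Rightarrow> real) \<Rightarrow> real) \<Rightarrow> real" where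
  "gc_expect \<mu> \<eta> N g =
     (\<integral>x. g x * exp (- \<mu> * (\<Sum>i<N. x i) - \<eta> * (\<Sum>i<N. (x i)^2)) \<partial>leb N)
     / (\<integral>x. exp (- \<mu> * (\<Sum>i<N. x i) - \<eta> * (\<Sum>i<N. (x i)^2)) \<partial>leb N)"

definition energy_set :: "real \<Rightarrow> real \<Rightarrow> real \<Rightarrow> real set" where
  "energy_set J h \<rho> = {\<epsilon>. \<epsilon> \<le> h^2 / (2*J) \<and>
       \<bar>\<bar>h\<bar> / J - sqrt (h^2 / J^2 - 2 * \<epsilon> / J)\<bar> < sqrt \<rho>}"

end

theory Submission
  imports Defs "HOL-Real_Asymp.Real_Asymp"
begin

text \<open>
  The microcanonical measure is compared with the Gaussian measure through a coupling: a vector x of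
  independent normal variables with mean m and variance \<rho> - m^2 is projected radially onto the surface.
  A function of the direction of the deviation vector and a function of its length V
  integrate independently against every product weight in V and the mean, since both Lebesgue integrals factor
  by translation and dilation invariance. Hence the projection of the Gaussian vector is microcanonically
  distributed, and the independence of V bounds all moments of the projection. As V has mean square
  (N - 1)(\<rho> - m^2) and fluctuations of order one, each projected coordinate differs from the original one by
  O(N^{-1/2}) in mean square, which suffices for functions of at most polynomial growth. In the fixed energy
  ensemble, the weight of the root of larger absolute value is exponentially small.
\<close>


text \<open>The delicate point is the division by V, which can be close to zero, so that bounds on
  the projected coordinates do not follow pointwise from Gaussian moments. Independence of V and the
  direction U = deviation / V removes it: E[U_i^(2q)] E[V^(2q)] is the moment of the i-th deviation,
  and E[V^(2q)] is bounded below by Jensen's inequality. Hence U_i^(2q) has expectation of order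
  N^(-q), with constants free of N. The factorization uses neither polar coordinates nor a surface
  measure: an integral is averaged over a unit mass of translations or dilations, and exchanging the
  integrals isolates the mean or the radius. It is stated for \<open>ennreal\<close>-valued
  functions, so that no integrability has to be known beforehand. The rate comes from Young's
  inequality a b \<le> s a^2 + b^2 / s with s = sqrt N: a mean square distance O(1/N) and bounded
  moments then both contribute O(N^(-1/2)).\<close>

definition affine_coords :: "nat \<Rightarrow> real \<Rightarrow> real \<Rightarrow> (nat \<Rightarrow> real) \<Rightarrow> (nat \<Rightarrow> real)" where
  "affine_coords N t c x = (\<lambda>i\<in>{..<N}. t + c * x i)"

lemma measurable_affine_coords [measurable]: "affine_coords N t c \<in> leb N \<rightarrow>\<^sub>M leb N"
  unfolding affine_coords_def by measurable

lemma measurable_coord: "i < N \<Longrightarrow> (\<lambda>x. x i) \<in> borel_measurable (leb N)"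
  using measurable_component_singleton[of i "{..<N}" "\<lambda>_. lborel :: real measure"] by simp

lemma measurable_vmean [measurable]: "vmean N \<in> borel_measurable (leb N)"
  unfolding vmean_def by measurable

lemma measurable_vdev [measurable]: "vdev N \<in> leb N \<rightarrow>\<^sub>M leb N"
  unfolding vdev_def by measurable

lemma measurable_vdev_component [measurable]: 
  "i < N \<Longrightarrow> (\<lambda>x. vdev N x i) \<in> borel_measurable (leb N)"
  unfolding vdev_def by simp

lemma measurable_vnorm [measurable]: "vnorm N \<in> borel_measurable (leb N)"
  unfolding vnorm_def by measurable

lemma measurable_mc_proj [measurable]: "mc_proj m \<rho> N \<in> leb N \<rightarrow>\<^sub>M leb N"
  unfolding mc_proj_def by measurable

interpretation lebp: product_sigma_finite "\<lambda>_::nat. lborel :: real measure"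
  by unfold_locales

section \<open>Lebesgue measure under translations and dilations\<close>

lemma emeasure_lborel_affine_vimage:
  fixes c :: real
  assumes "c > 0" "A \<in> sets borel"
  shows "ennreal c * emeasure lborel ((\<lambda>x. t + c * x) -` A) = emeasure lborel A"
proof -
  have "emeasure lborel A = (\<integral>\<^sup>+x. indicator A x \<partial>lborel)"
    using assms by simp
  also have "\<dots> = ennreal \<bar>c\<bar> * (\<integral>\<^sup>+x. indicator A (t + c * x) \<partial>lborel)"
    using assms by (intro nn_integral_real_affine) auto
  also have "(\<integral>\<^sup>+x. indicator A (t + c * x) \<partial>lborel) = (\<integral>\<^sup>+x. indicator ((\<lambda>x. t + c * x) -` A) x \<partial>lborel)"
    by (intro nn_integral_cong) (auto simp: indicator_def)
  also have "\<dots> = emeasure lborel ((\<lambda>x. t + c * x) -` A)"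
    using assms measurable_sets_borel[of "\<lambda>x. t + c * x" borel A] by simp
  finally show ?thesis using assms by simp
qed

text \<open>The rescaled image measure \<open>?P\<close> agrees with Lebesgue measure on boxes, each
  coordinate absorbing one factor c, and a product measure is determined by its values on
  boxes.\<close>

lemma nn_integral_leb_affine:
  assumes c: "c > 0" and F[measurable]: "F \<in> borel_measurable (leb N)"
  shows "(\<integral>\<^sup>+x. F x \<partial>leb N) = ennreal (c ^ N) * (\<integral>\<^sup>+x. F (affine_coords N t c x) \<partial>leb N)"
proof -
  let ?P = "density (distr (leb N) (leb N) (affine_coords N t c)) (\<lambda>_. ennreal (c ^ N))"
  have "?P = leb N"
  proof (rule lebp.PiM_eqI)
    fix A :: "nat \<Rightarrow> real set" assume A: "\<And>i. i \<in> {..<N} \<Longrightarrow> A i \<in> sets lborel"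
    let ?B = "\<lambda>i. (\<lambda>x. t + c * x) -` A i"
    have B: "?B i \<in> sets lborel" if "i < N" for i
      using measurable_sets_borel[of "\<lambda>x. t + c * x" borel "A i"] A[of i] that by simp
    have PA[measurable]: "Pi\<^sub>E {..<N} A \<in> sets (leb N)"
      using A by (intro sets_PiM_I_finite) auto
    have "affine_coords N t c -` Pi\<^sub>E {..<N} A \<inter> space (leb N) = Pi\<^sub>E {..<N} ?B"
      by (auto simp: affine_coords_def space_PiM PiE_iff)
    hence "emeasure ?P (Pi\<^sub>E {..<N} A) = ennreal (c ^ N) * emeasure (leb N) (Pi\<^sub>E {..<N} ?B)"
      by (simp add: emeasure_density nn_integral_cmult emeasure_distr)
    also have "\<dots> = (\<Prod>i<N. ennreal c * emeasure lborel (?B i))"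
      using B c by (subst lebp.emeasure_PiM) (auto simp: prod.distrib ennreal_power)
    also have "\<dots> = (\<Prod>i<N. emeasure lborel (A i))"
      using A c by (intro prod.cong refl emeasure_lborel_affine_vimage) auto
    finally show "emeasure ?P (Pi\<^sub>E {..<N} A) = (\<Prod>i<N. emeasure lborel (A i))" .
  qed auto
  hence "(\<integral>\<^sup>+x. F x \<partial>leb N) = (\<integral>\<^sup>+x. F x \<partial>?P)" by simp
  also have "\<dots> = ennreal (c ^ N) * (\<integral>\<^sup>+x. F (affine_coords N t c x) \<partial>leb N)"
    by (subst nn_integral_density) (auto simp: nn_integral_cmult nn_integral_distr)
  finally show ?thesis .
qed

lemma vmean_affine: "N > 0 \<Longrightarrow> vmean N (affine_coords N t c x) = t + c * vmean N x"
  by (simp add: vmean_def affine_coords_def sum.distrib sum_distrib_left[symmetric] add_divide_distrib)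

lemma vdev_affine: "N > 0 \<Longrightarrow> vdev N (affine_coords N t c x) i = (if i < N then c * vdev N x i else undefined)"
  by (auto simp: vdev_def vmean_affine) (simp add: affine_coords_def algebra_simps)

lemma vnorm_vdev_affine:
  assumes "N > 0" "c > 0" shows "vnorm N (vdev N (affine_coords N t c x)) = c * vnorm N (vdev N x)"
proof -
  have "(\<Sum>i<N. (vdev N (affine_coords N t c x) i)\<^sup>2) = c\<^sup>2 * (\<Sum>i<N. (vdev N x i)\<^sup>2)"
    using assms by (simp add: vdev_affine sum_distrib_left power_mult_distrib)
  thus ?thesis using assms by (simp add: vnorm_def real_sqrt_mult)
qed

text \<open>The translation cancels in the deviation and the factor c cancels in the quotient by its
  norm. Measurable functions of the projected point therefore qualify as \<open>G\<close> in the
  locale below.\<close>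

lemma mc_proj_affine:
  assumes "N > 0" "c > 0" shows "mc_proj m \<rho> N (affine_coords N t c x) = mc_proj m \<rho> N x"
  using assms by (auto simp: mc_proj_def vnorm_vdev_affine vdev_affine)

lemma vnorm_nonneg [simp]: "vnorm N z \<ge> 0"
  by (simp add: vnorm_def sum_nonneg)

section \<open>Factorization of cone integrals\<close>

text \<open>Invariance under all these maps says that \<open>G\<close> depends only on the direction
  of the deviation vector. For N = 1 that vector is always zero; 2 \<le> N also keeps the later
  exponent N - 2 free of truncation.\<close>

locale affine_invariant =
  fixes N :: nat and G :: "(nat \<Rightarrow> real) \<Rightarrow> ennreal"
  assumes measurable_G [measurable]: "G \<in> borel_measurable (leb N)"
    and invariant: "c > 0 \<Longrightarrow> G (affine_coords N t c x) = G x"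
    and two_le_N: "2 \<le> N"
begin

lemma N_pos: "N > 0" using two_le_N by simp

definition cone_integral :: "(real \<Rightarrow> ennreal) \<Rightarrow> (real \<Rightarrow> ennreal) \<Rightarrow> ennreal" where
  "cone_integral w k = (\<integral>\<^sup>+x. G x * w (vnorm N (vdev N x)) * k (vmean N x) \<partial>leb N)"

lemma cone_affine:
  assumes "c > 0" and [measurable]: "w \<in> borel_measurable borel" "k \<in> borel_measurable borel"
  shows "cone_integral w k = ennreal (c ^ N) * cone_integral (\<lambda>v. w (c * v)) (\<lambda>y. k (t + c * y))"
  unfolding cone_integral_def using assms(1) N_pos
  by (subst nn_integral_leb_affine[where c=c and t=t])
     (auto simp: vmean_affine vnorm_vdev_affine invariant)

lemma sigma_finite_leb: "sigma_finite_measure (leb N)"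
  by (rule lebp.sigma_finite) auto

text \<open>For fixed w the value is a translation invariant functional of k, hence a multiple of
  the Lebesgue integral; the unit interval identifies the multiple.\<close>

lemma cone_mean_factor:
  assumes [measurable]: "w \<in> borel_measurable borel" "k \<in> borel_measurable borel"
  shows "cone_integral w k = (\<integral>\<^sup>+u. k u \<partial>lborel) * cone_integral w (indicator {0..1})"
proof -
  interpret pair_sigma_finite "leb N" "lborel :: real measure"
    by (intro pair_sigma_finite.intro sigma_finite_leb) unfold_locales
  \<comment> \<open>The support of \<open>?j\<close> is the reflection of {0..1}: after the
    substitution u = t + \<open>vmean N x\<close>, the condition t \<in> [-1, 0] reads
    \<open>vmean N x\<close> - u \<in> [0, 1].\<close>
  let ?V = "\<lambda>x. vnorm N (vdev N x)" and ?j = "indicator {-1..0} :: real \<Rightarrow> ennreal"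
  have translate: "cone_integral w k' = cone_integral w (\<lambda>y. k' (t + y))" if [measurable]: "k' \<in> borel_measurable borel" for t k'
    using cone_affine[of 1 w k' t] by simp
  have shift: "cone_integral w (\<lambda>y. indicator {0..1} (- u + y)) = cone_integral w (indicator {0..1})" for u
    by (rule translate[symmetric]) simp
  \<comment> \<open>Averaging over translations by the unit mass \<open>?j\<close> and exchanging integrals swaps \<open>k\<close> with \<open>?j\<close>.\<close>
  have "(\<integral>\<^sup>+t. ?j t \<partial>lborel) = 1" by simp
  hence "cone_integral w k = (\<integral>\<^sup>+t. ?j t * cone_integral w k \<partial>lborel)"
    by (subst nn_integral_multc) auto
  also have "\<dots> = (\<integral>\<^sup>+t. ?j t * cone_integral w (\<lambda>y. k (t + y)) \<partial>lborel)"
    using translate[of k] by simp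
  also have "\<dots> = (\<integral>\<^sup>+t. (\<integral>\<^sup>+x. ?j t * (G x * w (?V x) * k (t + vmean N x)) \<partial>leb N) \<partial>lborel)"
    unfolding cone_integral_def by (subst nn_integral_cmult) auto
  also have "\<dots> = (\<integral>\<^sup>+x. (\<integral>\<^sup>+t. ?j t * (G x * w (?V x) * k (t + vmean N x)) \<partial>lborel) \<partial>leb N)"
    by (rule Fubini') measurable
  also have "\<dots> = (\<integral>\<^sup>+x. (\<integral>\<^sup>+u. k u * (G x * w (?V x) * indicator {0..1} (- u + vmean N x)) \<partial>lborel) \<partial>leb N)"
  proof (rule nn_integral_cong)
    fix x
    show "(\<integral>\<^sup>+t. ?j t * (G x * w (?V x) * k (t + vmean N x)) \<partial>lborel)
        = (\<integral>\<^sup>+u. k u * (G x * w (?V x) * indicator {0..1} (- u + vmean N x)) \<partial>lborel)"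
      by (subst nn_integral_real_affine[where c=1 and t="- vmean N x"], measurable)
         (auto intro!: nn_integral_cong simp: indicator_def mult_ac)
  qed
  also have "\<dots> = (\<integral>\<^sup>+u. (\<integral>\<^sup>+x. k u * (G x * w (?V x) * indicator {0..1} (- u + vmean N x)) \<partial>leb N) \<partial>lborel)"
    by (rule Fubini'[symmetric]) measurable
  also have "\<dots> = (\<integral>\<^sup>+u. k u * cone_integral w (\<lambda>y. indicator {0..1} (- u + y)) \<partial>lborel)"
    unfolding cone_integral_def by (subst nn_integral_cmult) auto
  also have "\<dots> = (\<integral>\<^sup>+u. k u * cone_integral w (indicator {0..1}) \<partial>lborel)"
    by (simp only: shift)
  finally show ?thesis by (simp add: nn_integral_multc)
qed

text \<open>A dilation of R^N contributes c^N, but it also changes the window of the mean to length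
  1/c. Undoing this by the mean factorization leaves N - 1, the dimension of the hyperplane of
  deviations.\<close>

lemma cone_dilate:
  assumes "c > 0" and [measurable]: "w \<in> borel_measurable borel"
  shows "cone_integral w (indicator {0..1}) = ennreal (c ^ (N - 1)) * cone_integral (\<lambda>v. w (c * v)) (indicator {0..1})"
proof -
  have "(\<integral>\<^sup>+u. indicator {0..1::real} (c * u) \<partial>lborel) = (\<integral>\<^sup>+u. indicator {0..1/c} u \<partial>lborel)"
    using assms by (intro nn_integral_cong) (auto simp: indicator_def field_simps zero_le_mult_iff)
  hence *: "(\<integral>\<^sup>+u. indicator {0..1::real} (c * u) \<partial>lborel) = ennreal (1 / c)"
    using assms by simp
  have "cone_integral w (indicator {0..1}) = ennreal (c ^ N) * cone_integral (\<lambda>v. w (c * v)) (\<lambda>y. indicator {0..1} (c * y))"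
    using cone_affine[of c w "indicator {0..1}" 0] assms by simp
  also have "cone_integral (\<lambda>v. w (c * v)) (\<lambda>y. indicator {0..1} (c * y))
      = ennreal (1 / c) * cone_integral (\<lambda>v. w (c * v)) (indicator {0..1})"
    by (subst cone_mean_factor) (auto simp: *)
  also have "ennreal (c ^ N) * (ennreal (1 / c) * cone_integral (\<lambda>v. w (c * v)) (indicator {0..1}))
     = ennreal (c ^ (N - 1)) * cone_integral (\<lambda>v. w (c * v)) (indicator {0..1})"
    using assms N_pos by (subst mult.assoc[symmetric], subst ennreal_mult[symmetric]) 
      (auto simp: power_diff)
  finally show ?thesis .
qed

end

text \<open>The mass t of the points with zero deviation and mean in [0, 1] satisfies t = 2^(N-1) t,
  because {0} is invariant under dilations. It is finite, as such points lie in the unit cube, so it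
  vanishes once 2^(N-1) > 1.\<close>

lemma AE_vnorm_vdev_nonzero:
  assumes N: "2 \<le> N"
  shows "AE x in leb N. vnorm N (vdev N x) \<noteq> 0"
proof -
  interpret affine_invariant N "\<lambda>_. 1"
    using N by unfold_locales auto
  let ?V = "\<lambda>x. vnorm N (vdev N x)"
  let ?t = "cone_integral (indicator {0}) (indicator {0..1})"
  have "?t \<le> (\<integral>\<^sup>+x. indicator (Pi\<^sub>E {..<N} (\<lambda>_. {0..1})) x \<partial>leb N)"
    unfolding cone_integral_def
  proof (intro nn_integral_mono)
    fix x assume "x \<in> space (leb N)"
    moreover have "x i = vmean N x" if "?V x = 0" "i < N" for i
    proof -
      have "(\<Sum>i<N. (vdev N x i)\<^sup>2) = 0" using that by (simp add: vnorm_def sum_nonneg)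
      hence "(vdev N x i)\<^sup>2 = 0" using that by (subst (asm) sum_nonneg_eq_0_iff) auto
      thus ?thesis using that by (simp add: vdev_def)
    qed
    ultimately show "1 * indicator {0} (?V x) * indicator {0..1} (vmean N x)
        \<le> (indicator (Pi\<^sub>E {..<N} (\<lambda>_. {0..1})) x :: ennreal)"
      by (auto simp: indicator_def space_PiM PiE_iff)
  qed
  also have "\<dots> = emeasure (leb N) (Pi\<^sub>E {..<N} (\<lambda>_. {0..1}))"
    by (intro nn_integral_indicator sets_PiM_I_finite) auto
  also have "\<dots> = 1" by (subst lebp.emeasure_PiM) auto
  finally have fin: "?t \<le> 1" .
  have dil: "(indicator {0} (2 * v) :: ennreal) = indicator {0} v" for v :: real by (auto simp: indicator_def)
  have "?t = ennreal (2 ^ (N - 1)) * ?t"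
    by (subst cone_dilate[of 2]) (auto simp: dil)
  moreover obtain r where r: "?t = ennreal r" "r \<ge> 0" 
    using fin by (cases "?t") (auto simp: top_unique)
  ultimately have "r = 2 ^ (N - 1) * r" by (simp add: ennreal_mult[symmetric] del: ennreal_power)
  moreover have "(1::real) < 2 ^ (N - 1)" using N by (intro one_less_power) auto
  ultimately have "r = 0" by (metis less_irrefl mult_cancel_right1)
  \<comment> \<open>The window of the mean is widened to the whole line: the integral of 1 is
    infinite, but \<infinity> * 0 = 0 in \<open>ennreal\<close>.\<close>
  hence "cone_integral (indicator {0}) (\<lambda>_. 1) = 0"
    using cone_mean_factor[of "indicator {0}" "\<lambda>_. 1"] r by simp
  hence "AE x in leb N. (indicator {0} (?V x) :: ennreal) = 0"
    unfolding cone_integral_def by (subst (asm) nn_integral_0_iff_AE) auto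
  thus ?thesis by eventually_elim (auto simp: indicator_def)
qed

context affine_invariant
begin

text \<open>The cone measure is a product measure in the radius (weight \<open>s ^ (N - 2)\<close>) and the direction;
  this is the integral of \<open>G\<close> over directions, computed on the complement of the unit ball, where the
  weight \<open>1 / v ^ N\<close> is integrable.\<close>
definition angular :: ennreal where
  "angular = cone_integral (\<lambda>v. ennreal (if 1 \<le> v then 1 / v ^ N else 0)) (indicator {0..1})"

text \<open>Averaging over dilations c in (0, 1] and substituting s = c V turns c^(N-1) dc into
  s^(N-1) / V^N ds on 0 < s \<le> V. After the exchange of integrals, the condition s \<le> V cuts
  the weight 1 / V^N off near 0, and by homogeneity its integral is a multiple of
  \<open>angular\<close>.\<close>

lemma cone_radial_factor:
  assumes [measurable]: "w \<in> borel_measurable borel"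
  shows "cone_integral w (indicator {0..1}) =
    (\<integral>\<^sup>+s. w s * ennreal (s ^ (N - 2)) * indicator {0<..} s \<partial>lborel) * angular"
proof -
  interpret pair_sigma_finite "leb N" "lborel :: real measure"
    by (intro pair_sigma_finite.intro sigma_finite_leb) unfold_locales
  let ?V = "\<lambda>x. vnorm N (vdev N x)" and ?i = "\<lambda>x. indicator {0..1} (vmean N x) :: ennreal"
  let ?S = "\<lambda>w. cone_integral w (indicator {0..1})"
  let ?w = "\<lambda>s v. ennreal (if s \<le> v then 1 / v ^ N else 0)"
  have "(\<integral>\<^sup>+c. indicator {0<..1::real} c \<partial>lborel) = 1" by simp
  hence "?S w = (\<integral>\<^sup>+c. indicator {0<..1::real} c * ?S w \<partial>lborel)"
    by (subst nn_integral_multc) auto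
  also have "\<dots> = (\<integral>\<^sup>+c. indicator {0<..1::real} c * ennreal (c ^ (N - 1)) * ?S (\<lambda>v. w (c * v)) \<partial>lborel)"
    by (rule nn_integral_cong) (auto simp: indicator_def cone_dilate[of _ w])
  also have "\<dots> = (\<integral>\<^sup>+c. (\<integral>\<^sup>+x. indicator {0<..1} c * ennreal (c ^ (N - 1)) * (G x * w (c * ?V x) * ?i x) \<partial>leb N) \<partial>lborel)"
    unfolding cone_integral_def by (subst nn_integral_cmult) auto
  also have "\<dots> = (\<integral>\<^sup>+x. (\<integral>\<^sup>+c. indicator {0<..1} c * ennreal (c ^ (N - 1)) * (G x * w (c * ?V x) * ?i x) \<partial>lborel) \<partial>leb N)"
    by (rule Fubini') measurable
  \<comment> \<open>The substitution s = c V needs V > 0, so the integrands agree only almost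
    everywhere.\<close>
  also have "\<dots> = (\<integral>\<^sup>+x. (\<integral>\<^sup>+s. w s * ennreal (s ^ (N - 1)) * indicator {0<..} s * (G x * ?w s (?V x) * ?i x) \<partial>lborel) \<partial>leb N)"
    using AE_vnorm_vdev_nonzero[OF two_le_N]
  proof (intro nn_integral_cong_AE, eventually_elim)
    fix x assume nz: "?V x \<noteq> 0"
    define v where "v = ?V x"
    have v: "v > 0" using nz vnorm_nonneg[of N "vdev N x"] by (simp add: v_def less_le)
    have "v ^ N = v * v ^ (N - 1)"
      using power_minus_mult[OF N_pos, of v] by (simp only: mult.commute)
    hence vN: "v * (v ^ (N - 1) / v ^ N) = 1"
      using v by simp
    define F where "F s = w s * ennreal (s ^ (N - 1)) * indicator {0<..} s * (G x * ?w s v * ?i x)" for s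
    have F_measurable [measurable]: "F \<in> borel_measurable borel"
      unfolding F_def by measurable
    have "(\<integral>\<^sup>+s. F s \<partial>lborel) = ennreal v * (\<integral>\<^sup>+c. F (v * c) \<partial>lborel)"
      using v nn_integral_real_affine[of F v 0] by simp
    also have "\<dots> = (\<integral>\<^sup>+c. ennreal v * F (v * c) \<partial>lborel)"
      by (rule nn_integral_cmult[symmetric]) measurable
    also have "\<dots> = (\<integral>\<^sup>+c. indicator {0<..1} c * ennreal (c ^ (N - 1)) * (G x * w (c * v) * ?i x) \<partial>lborel)"
    proof (rule nn_integral_cong)
      fix c :: real
      consider "c \<in> {0<..1}" | "c \<le> 0" | "c > 1" by force
      thus "ennreal v * F (v * c)
         = indicator {0<..1} c * ennreal (c ^ (N - 1)) * (G x * w (c * v) * ?i x)"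
      proof cases
        case 1
        have "c ^ (N - 1) = v * (c ^ (N - 1) * (v ^ (N - 1) / v ^ N))"
          using vN by (metis mult.left_commute mult.right_neutral)
        hence "ennreal (c ^ (N - 1)) = ennreal (v * (c ^ (N - 1) * (v ^ (N - 1) / v ^ N)))"
          by (rule arg_cong)
        also have "\<dots> = ennreal v * (ennreal ((v * c) ^ (N - 1)) * ennreal (1 / v ^ N))"
          using v 1 by (simp add: ennreal_mult[symmetric] power_mult_distrib mult_ac del: ennreal_power)
        finally have "ennreal (c ^ (N - 1)) = ennreal v * (ennreal ((v * c) ^ (N - 1)) * ennreal (1 / v ^ N))" .
        thus ?thesis using v 1 by (simp only: F_def) (simp add: mult_ac del: ennreal_power)
      next
        case 2 thus ?thesis using v by (auto simp: F_def indicator_def zero_less_mult_iff)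
      next
        case 3 thus ?thesis using v by (auto simp: F_def indicator_def)
      qed
    qed
    finally show "(\<integral>\<^sup>+c. indicator {0<..1} c * ennreal (c ^ (N - 1)) * (G x * w (c * ?V x) * ?i x) \<partial>lborel)
       = (\<integral>\<^sup>+s. w s * ennreal (s ^ (N - 1)) * indicator {0<..} s * (G x * ?w s (?V x) * ?i x) \<partial>lborel)"
      unfolding F_def v_def by (rule sym)
  qed
  also have "\<dots> = (\<integral>\<^sup>+s. (\<integral>\<^sup>+x. w s * ennreal (s ^ (N - 1)) * indicator {0<..} s * (G x * ?w s (?V x) * ?i x) \<partial>leb N) \<partial>lborel)"
    by (rule Fubini'[symmetric]) measurable
  also have "\<dots> = (\<integral>\<^sup>+s. w s * ennreal (s ^ (N - 1)) * indicator {0<..} s * ?S (?w s) \<partial>lborel)"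
    unfolding cone_integral_def by (subst nn_integral_cmult) auto
  also have "\<dots> = (\<integral>\<^sup>+s. w s * ennreal (s ^ (N - 2)) * indicator {0<..} s * angular \<partial>lborel)"
  proof (rule nn_integral_cong)
    fix s :: real
    show "w s * ennreal (s ^ (N - 1)) * indicator {0<..} s * ?S (?w s)
        = w s * ennreal (s ^ (N - 2)) * indicator {0<..} s * angular"
    proof (cases "s > 0")
      case True
      \<comment> \<open>Rescaling the cutoff from s to 1 costs s^(N-1) s^(-N) = 1/s, which lowers
        the exponent N - 1 of the radial weight to N - 2.\<close>
      have "?S (?w s) = ennreal (s ^ (N - 1)) * ?S (\<lambda>v. ?w s (s * v))"
        using True by (intro cone_dilate) auto
      also have "(\<lambda>v. ?w s (s * v)) = (\<lambda>v. ennreal (1 / s ^ N) * ?w 1 v)"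
        using True by (auto simp: fun_eq_iff ennreal_mult[symmetric] power_mult_distrib)
      also have "?S \<dots> = ennreal (1 / s ^ N) * angular"
        unfolding angular_def cone_integral_def by (subst nn_integral_cmult[symmetric]) (auto simp: mult_ac)
      finally have S: "?S (?w s) = ennreal (s ^ (N - 1)) * (ennreal (1 / s ^ N) * angular)" .
      have "s ^ (N - 1) * (s ^ (N - 1) * (1 / s ^ N)) = s ^ (N - 2)"
      proof -
        obtain n where "N = Suc (Suc n)" using two_le_N by (metis add_2_eq_Suc le_Suc_ex)
        thus ?thesis using True by (simp add: field_simps)
      qed
      hence "ennreal (s ^ (N - 1)) * (ennreal (s ^ (N - 1)) * ennreal (1 / s ^ N)) = ennreal (s ^ (N - 2))"
        using True by (simp add: ennreal_mult[symmetric] del: ennreal_power)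
      thus ?thesis using True by (simp add: S mult_ac del: ennreal_power)
    qed auto
  qed
  finally show ?thesis by (simp add: nn_integral_multc)
qed

text \<open>This stands in for polar coordinates. \<open>G\<close> enters only through
  \<open>angular\<close>, so that all choices of the weights lead to the same law of the direction,
  up to a factor.\<close>

lemma cone_factor:
  assumes [measurable]: "w \<in> borel_measurable borel" "k \<in> borel_measurable borel"
  shows "cone_integral w k = (\<integral>\<^sup>+u. k u \<partial>lborel) *
    (\<integral>\<^sup>+s. w s * ennreal (s ^ (N - 2)) * indicator {0<..} s \<partial>lborel) * angular"
  by (simp add: cone_mean_factor[of w k] cone_radial_factor mult.assoc)

end

section \<open>Gaussian vectors and their projection\<close>

text \<open>Completing the square identifies this with the grand canonical measure for \<eta> = 1/(2
  \<sigma>^2) and \<mu> = -m/\<sigma>^2; the product form exposes the independence of the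
  coordinates.\<close>

definition gauss :: "real \<Rightarrow> real \<Rightarrow> nat \<Rightarrow> (nat \<Rightarrow> real) measure" where
  "gauss m \<sigma> N = PiM {..<N} (\<lambda>_. density lborel (\<lambda>x. ennreal (normal_density m \<sigma> x)))"

lemma sets_gauss [measurable_cong, simp]: "sets (gauss m \<sigma> N) = sets (leb N)"
  unfolding gauss_def by (intro sets_PiM_cong) auto

lemma space_gauss [simp]: "space (gauss m \<sigma> N) = space (leb N)"
  by (rule sets_eq_imp_space_eq) simp

text \<open>Moments are computed from the product form, whereas the cone integrals need a density
  with respect to Lebesgue measure. Both measures agree on boxes.\<close>

lemma gauss_eq_density:
  assumes "\<sigma> > 0"
  shows "gauss m \<sigma> N = density (leb N) (\<lambda>x. ennreal (\<Prod>i<N. normal_density m \<sigma> (x i)))"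
proof -
  interpret n: prob_space "density lborel (\<lambda>x. ennreal (normal_density m \<sigma> x))"
    by (rule prob_space_normal_density) fact
  interpret g: product_sigma_finite "\<lambda>_::nat. density lborel (\<lambda>x. ennreal (normal_density m \<sigma> x))"
    by unfold_locales
  show ?thesis unfolding gauss_def
  proof (rule g.PiM_eqI[symmetric])
    show "sets (density (leb N) (\<lambda>x. ennreal (\<Prod>i<N. normal_density m \<sigma> (x i))))
       = sets (PiM {..<N} (\<lambda>_. density lborel (\<lambda>x. ennreal (normal_density m \<sigma> x))))"
      using sets_gauss[of m \<sigma> N] by (simp add: gauss_def)
    fix A :: "nat \<Rightarrow> real set"
    assume A: "\<And>i. i \<in> {..<N} \<Longrightarrow> A i \<in> sets (density lborel (\<lambda>x. ennreal (normal_density m \<sigma> x)))"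
    have "Pi\<^sub>E {..<N} A \<in> sets (leb N)"
      using A by (intro sets_PiM_I_finite) auto
    hence "emeasure (density (leb N) (\<lambda>x. ennreal (\<Prod>i<N. normal_density m \<sigma> (x i)))) (Pi\<^sub>E {..<N} A)
       = (\<integral>\<^sup>+x. ennreal (\<Prod>i<N. normal_density m \<sigma> (x i)) * indicator (Pi\<^sub>E {..<N} A) x \<partial>leb N)"
      by (subst emeasure_density) auto
    also have "\<dots> = (\<integral>\<^sup>+x. (\<Prod>i<N. ennreal (normal_density m \<sigma> (x i)) * indicator (A i) (x i)) \<partial>leb N)"
    proof (rule nn_integral_cong)
      fix x assume x: "x \<in> space (leb N)"
      have "(indicator (Pi\<^sub>E {..<N} A) x :: ennreal) = (\<Prod>i<N. indicator (A i) (x i))"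
        using x by (auto simp: indicator_def space_PiM PiE_iff Ball_def)
      thus "ennreal (\<Prod>i<N. normal_density m \<sigma> (x i)) * indicator (Pi\<^sub>E {..<N} A) x
        = (\<Prod>i<N. ennreal (normal_density m \<sigma> (x i)) * indicator (A i) (x i))"
        by (simp add: prod.distrib prod_ennreal)
    qed
    also have "\<dots> = (\<Prod>i<N. \<integral>\<^sup>+x. ennreal (normal_density m \<sigma> x) * indicator (A i) x \<partial>lborel)"
      using A by (intro lebp.product_nn_integral_prod) auto
    also have "\<dots> = (\<Prod>i<N. emeasure (density lborel (\<lambda>x. ennreal (normal_density m \<sigma> x))) (A i))"
      using A by (intro prod.cong refl emeasure_density[symmetric]) auto
    finally show "emeasure (density (leb N) (\<lambda>x. ennreal (\<Prod>i<N. normal_density m \<sigma> (x i)))) (Pi\<^sub>E {..<N} A)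
       = (\<Prod>i<N. emeasure (density lborel (\<lambda>x. ennreal (normal_density m \<sigma> x))) (A i))" .
  qed auto
qed

text \<open>Pythagoras: the deviations from the mean sum to zero, which kills the cross term. By
  this identity the Gaussian density is a function of the radius times a function of the
  mean.\<close>

lemma sum_square_decompose:
  assumes "N > 0"
  shows "(\<Sum>i<N. (x i - m)\<^sup>2) = (vnorm N (vdev N x))\<^sup>2 + real N * (vmean N x - m)\<^sup>2"
proof -
  let ?a = "vmean N x"
  have z: "(\<Sum>i<N. x i - ?a) = 0" using assms by (simp add: sum_subtractf vmean_def)
  have "(\<Sum>i<N. (x i - m)\<^sup>2) = (\<Sum>i<N. (x i - ?a)\<^sup>2 + 2 * (?a - m) * (x i - ?a) + (?a - m)\<^sup>2)"
    by (intro sum.cong refl) (simp add: power2_eq_square algebra_simps)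
  also have "\<dots> = (\<Sum>i<N. (x i - ?a)\<^sup>2) + real N * (?a - m)\<^sup>2"
    by (simp add: sum.distrib sum_distrib_left[symmetric] z)
  also have "(\<Sum>i<N. (x i - ?a)\<^sup>2) = (vnorm N (vdev N x))\<^sup>2"
    by (simp add: vnorm_def vdev_def sum_nonneg)
  finally show ?thesis .
qed

lemma prod_normal_density:
  "(\<Prod>i<N. normal_density m \<sigma> (x i)) = (1 / sqrt (2 * pi * \<sigma>\<^sup>2)) ^ N * exp (- (\<Sum>i<N. (x i - m)\<^sup>2) / (2 * \<sigma>\<^sup>2))"
  by (simp add: normal_density_def prod.distrib prod_dividef power_divide
      exp_sum[symmetric] sum_negf sum_divide_distrib power_one_over)

locale gaussian_vector =
  fixes m \<sigma> :: real and N :: nat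
  assumes \<sigma>_pos: "\<sigma> > 0" and two_le_N: "2 \<le> N"
begin

abbreviation Q where "Q \<equiv> gauss m \<sigma> N"
abbreviation V where "V \<equiv> \<lambda>x. vnorm N (vdev N x)"

lemma prob_space_normal: "prob_space (density lborel (\<lambda>x. ennreal (normal_density m \<sigma> x)))"
  by (rule prob_space_normal_density[OF \<sigma>_pos])

sublocale prob_space Q
  unfolding gauss_def by (intro prob_space_PiM prob_space_normal)

lemma N_pos: "N > 0" using two_le_N by simp

lemma prob_space_leb [simp]: "prob (space (leb N)) = 1"
  using prob_space by simp

lemma emeasure_space_leb: "emeasure Q (space (leb N)) = 1"
  using emeasure_space_1 by simp

lemma nn_integral_gauss_eq_cone:
  assumes "affine_invariant N G" and [measurable]: "w \<in> borel_measurable borel"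
  shows "(\<integral>\<^sup>+x. G x * w (V x) \<partial>Q) = affine_invariant.cone_integral N G
     (\<lambda>v. w v * ennreal (exp (- v\<^sup>2 / (2 * \<sigma>\<^sup>2))))
     (\<lambda>y. ennreal ((1 / sqrt (2 * pi * \<sigma>\<^sup>2)) ^ N * exp (- real N * (y - m)\<^sup>2 / (2 * \<sigma>\<^sup>2))))"
proof -
  interpret affine_invariant N G by fact
  have "(\<integral>\<^sup>+x. G x * w (V x) \<partial>Q) 
      = (\<integral>\<^sup>+x. ennreal (\<Prod>i<N. normal_density m \<sigma> (x i)) * (G x * w (V x)) \<partial>leb N)"
    unfolding gauss_eq_density[OF \<sigma>_pos] by (subst nn_integral_density) auto
  also have "\<dots> = cone_integral (\<lambda>v. w v * ennreal (exp (- v\<^sup>2 / (2 * \<sigma>\<^sup>2))))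
     (\<lambda>y. ennreal ((1 / sqrt (2 * pi * \<sigma>\<^sup>2)) ^ N * exp (- real N * (y - m)\<^sup>2 / (2 * \<sigma>\<^sup>2))))"
    unfolding cone_integral_def
  proof (rule nn_integral_cong)
    fix x
    have "ennreal (\<Prod>i<N. normal_density m \<sigma> (x i)) =
       ennreal (exp (- (V x)\<^sup>2 / (2 * \<sigma>\<^sup>2))) * 
       ennreal ((1 / sqrt (2 * pi * \<sigma>\<^sup>2)) ^ N * exp (- real N * (vmean N x - m)\<^sup>2 / (2 * \<sigma>\<^sup>2)))"
      by (simp add: prod_normal_density sum_square_decompose[OF N_pos] ennreal_mult[symmetric]
          exp_add[symmetric] add_divide_distrib diff_divide_distrib del: ennreal_power)
    thus "ennreal (\<Prod>i<N. normal_density m \<sigma> (x i)) * (G x * w (V x)) = G x *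
       (w (V x) * ennreal (exp (- (V x)\<^sup>2 / (2 * \<sigma>\<^sup>2)))) *
       ennreal ((1 / sqrt (2 * pi * \<sigma>\<^sup>2)) ^ N * exp (- real N * (vmean N x - m)\<^sup>2 / (2 * \<sigma>\<^sup>2)))"
      by (simp add: mult_ac)
  qed
  finally show ?thesis .
qed

lemma affine_invariant_one: "affine_invariant N (\<lambda>_. 1)"
  using two_le_N by unfold_locales auto

text \<open>The number b is the Gaussian integral over the mean. Its value never matters, since the
  case G = w = 1 ties it to the total mass 1; what matters is that one b serves all \<open>G\<close>
  and \<open>w\<close>.\<close>

lemma gauss_factors:
  obtains b where
    "\<And>G w. affine_invariant N G \<Longrightarrow> w \<in> borel_measurable borel \<Longrightarrow>
      (\<integral>\<^sup>+x. G x * w (V x) \<partial>Q) = b *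
       (\<integral>\<^sup>+s. w s * ennreal (exp (- s\<^sup>2 / (2 * \<sigma>\<^sup>2))) * ennreal (s ^ (N - 2)) * indicator {0<..} s \<partial>lborel)
       * affine_invariant.angular N G"
proof 
  fix G and w :: "real \<Rightarrow> ennreal" assume G: "affine_invariant N G" and [measurable]: "w \<in> borel_measurable borel"
  interpret affine_invariant N G by fact
  show "(\<integral>\<^sup>+x. G x * w (V x) \<partial>Q) =
     (\<integral>\<^sup>+y. ennreal ((1 / sqrt (2 * pi * \<sigma>\<^sup>2)) ^ N * exp (- real N * (y - m)\<^sup>2 / (2 * \<sigma>\<^sup>2))) \<partial>lborel) *
       (\<integral>\<^sup>+s. w s * ennreal (exp (- s\<^sup>2 / (2 * \<sigma>\<^sup>2))) * ennreal (s ^ (N - 2)) * indicator {0<..} s \<partial>lborel)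
       * angular"
    by (subst nn_integral_gauss_eq_cone[OF G]) (simp_all add: cone_factor)
qed

lemma nn_integral_gauss_independent:
  assumes G: "affine_invariant N G" and w: "w \<in> borel_measurable borel"
  shows "(\<integral>\<^sup>+x. G x * w (V x) \<partial>Q) = (\<integral>\<^sup>+x. G x \<partial>Q) * (\<integral>\<^sup>+x. w (V x) \<partial>Q)"
proof -
  from gauss_factors obtain b where b: "\<And>G w. affine_invariant N G \<Longrightarrow> w \<in> borel_measurable borel \<Longrightarrow>
      (\<integral>\<^sup>+x. G x * w (V x) \<partial>Q) = b *
       (\<integral>\<^sup>+s. w s * ennreal (exp (- s\<^sup>2 / (2 * \<sigma>\<^sup>2))) * ennreal (s ^ (N - 2)) * indicator {0<..} s \<partial>lborel)
       * affine_invariant.angular N G" by blast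
  let ?c = "\<lambda>w. \<integral>\<^sup>+s. w s * ennreal (exp (- s\<^sup>2 / (2 * \<sigma>\<^sup>2))) * ennreal (s ^ (N - 2)) * indicator {0<..} s \<partial>lborel"
  let ?L = "affine_invariant.angular N"
  note one = affine_invariant_one
  have 1: "1 = b * ?c (\<lambda>_. 1) * ?L (\<lambda>_. 1)"
    using b[OF one, of "\<lambda>_. 1"] by (simp add: emeasure_space_leb)
  \<comment> \<open>Multiplying by the total mass 1 in factored form and regrouping replaces a
    division, which would be awkward in \<open>ennreal\<close>.\<close>
  have "(\<integral>\<^sup>+x. G x * w (V x) \<partial>Q) = (b * ?c w * ?L G) * (b * ?c (\<lambda>_. 1) * ?L (\<lambda>_. 1))"
    unfolding b[OF G w] 1[symmetric] by simp
  also have "\<dots> = (b * ?c (\<lambda>_. 1) * ?L G) * (b * ?c w * ?L (\<lambda>_. 1))"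
    by (simp only: mult_ac)
  also have "b * ?c (\<lambda>_. 1) * ?L G = (\<integral>\<^sup>+x. G x \<partial>Q)"
    using b[OF G, of "\<lambda>_. 1"] by simp
  also have "b * ?c w * ?L (\<lambda>_. 1) = (\<integral>\<^sup>+x. w (V x) \<partial>Q)"
    using b[OF one w] by simp
  finally show ?thesis .
qed

section \<open>The microcanonical measure as the law of the projected Gaussian vector\<close>

lemma sets_mc_cyl [measurable]: "mc_cyl m' \<rho> N \<in> sets (leb N)"
proof -
  have "mc_cyl m' \<rho> N = {x \<in> space (leb N). V x \<le> mc_radius m' \<rho> N \<and> 0 \<le> vmean N x \<and> vmean N x \<le> 1}"
    by (auto simp: mc_cyl_def space_PiM)
  also have "\<dots> \<in> sets (leb N)" by measurable
  finally show ?thesis .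
qed

lemma nn_integral_mc_cyl_eq_cone:
  assumes "affine_invariant N G"
  shows "(\<integral>\<^sup>+x. G x * indicator (mc_cyl m' \<rho> N) x \<partial>leb N)
     = affine_invariant.cone_integral N G (indicator {..mc_radius m' \<rho> N}) (indicator {0..1})"
proof -
  interpret affine_invariant N G by fact
  show ?thesis unfolding cone_integral_def
    by (rule nn_integral_cong) (auto simp: indicator_def mc_cyl_def space_PiM)
qed

lemma mc_cyl_factors:
  "affine_invariant N G \<Longrightarrow> (\<integral>\<^sup>+x. G x * indicator (mc_cyl m' \<rho> N) x \<partial>leb N)
     = (\<integral>\<^sup>+s. indicator {..mc_radius m' \<rho> N} s * ennreal (s ^ (N - 2)) * indicator {0<..} s \<partial>lborel)
       * affine_invariant.angular N G"
  by (simp add: nn_integral_mc_cyl_eq_cone affine_invariant.cone_factor)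

text \<open>Cylinder and Gaussian measure have the same angular factor, so the uniform measure on
  the cylinder and \<open>Q\<close> give \<open>G\<close> the same average. The parameter m' affects
  only the radius of the cylinder.\<close>

lemma nn_integral_mc_cyl:
  assumes G: "affine_invariant N G" 
  shows "(\<integral>\<^sup>+x. G x * indicator (mc_cyl m' \<rho> N) x \<partial>leb N) = 
    emeasure (leb N) (mc_cyl m' \<rho> N) * (\<integral>\<^sup>+x. G x \<partial>Q)"
proof -
  from gauss_factors obtain b where b: "\<And>G w. affine_invariant N G \<Longrightarrow> w \<in> borel_measurable borel \<Longrightarrow>
      (\<integral>\<^sup>+x. G x * w (V x) \<partial>Q) = b *
       (\<integral>\<^sup>+s. w s * ennreal (exp (- s\<^sup>2 / (2 * \<sigma>\<^sup>2))) * ennreal (s ^ (N - 2)) * indicator {0<..} s \<partial>lborel)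
       * affine_invariant.angular N G" by blast
  let ?c = "\<integral>\<^sup>+s. ennreal (exp (- s\<^sup>2 / (2 * \<sigma>\<^sup>2))) * ennreal (s ^ (N - 2)) * indicator {0<..} s \<partial>lborel"
  let ?R = "\<integral>\<^sup>+s. indicator {..mc_radius m' \<rho> N} s * ennreal (s ^ (N - 2)) * indicator {0<..} s \<partial>lborel"
  let ?L = "affine_invariant.angular N"
  note one = affine_invariant_one
  have 1: "1 = b * ?c * ?L (\<lambda>_. 1)"
    using b[OF one, of "\<lambda>_. 1"] by (simp add: emeasure_space_leb)
  have "(\<integral>\<^sup>+x. G x * indicator (mc_cyl m' \<rho> N) x \<partial>leb N) = (?R * ?L G) * (b * ?c * ?L (\<lambda>_. 1))"
    unfolding mc_cyl_factors[OF G] 1[symmetric] by simp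
  also have "\<dots> = (?R * ?L (\<lambda>_. 1)) * (b * ?c * ?L G)"
    by (simp only: mult_ac)
  also have "?R * ?L (\<lambda>_. 1) = emeasure (leb N) (mc_cyl m' \<rho> N)"
    using mc_cyl_factors[OF one, of m' \<rho>] by simp
  also have "b * ?c * ?L G = (\<integral>\<^sup>+x. G x \<partial>Q)"
    using b[OF G, of "\<lambda>_. 1"] by simp
  finally show ?thesis .
qed

text \<open>The angular factor is positive and finite since the Gaussian total mass is 1. The radial
  factor is at most R^(N-2) R, and at least (R/2)^(N-2) R/2 by the contribution of [R/2, R].\<close>

lemma emeasure_mc_cyl_pos_finite:
  assumes "m'\<^sup>2 < \<rho>"
  shows "emeasure (leb N) (mc_cyl m' \<rho> N) \<noteq> 0" "emeasure (leb N) (mc_cyl m' \<rho> N) \<noteq> \<infinity>"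
proof -
  from gauss_factors obtain b where b: "\<And>G w. affine_invariant N G \<Longrightarrow> w \<in> borel_measurable borel \<Longrightarrow>
      (\<integral>\<^sup>+x. G x * w (V x) \<partial>Q) = b *
       (\<integral>\<^sup>+s. w s * ennreal (exp (- s\<^sup>2 / (2 * \<sigma>\<^sup>2))) * ennreal (s ^ (N - 2)) * indicator {0<..} s \<partial>lborel)
       * affine_invariant.angular N G" by blast
  define R where "R = mc_radius m' \<rho> N"
  have R: "R > 0" using assms N_pos by (simp add: R_def mc_radius_def)
  let ?c = "\<integral>\<^sup>+s. ennreal (exp (- s\<^sup>2 / (2 * \<sigma>\<^sup>2))) * ennreal (s ^ (N - 2)) * indicator {0<..} s \<partial>lborel"
  let ?R = "\<integral>\<^sup>+s. indicator {..R} s * ennreal (s ^ (N - 2)) * indicator {0<..} s \<partial>lborel"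
  let ?L = "affine_invariant.angular N (\<lambda>_. 1)"
  have 1: "1 = b * ?c * ?L"
    using b[OF affine_invariant_one, of "\<lambda>_. 1"] by (simp add: emeasure_space_leb)
  have vol: "emeasure (leb N) (mc_cyl m' \<rho> N) = ?R * ?L"
    using mc_cyl_factors[OF affine_invariant_one, of m' \<rho>] by (simp add: R_def)
  define B where "B = b * ?c"
  have BL: "B * ?L = 1" using 1 by (simp only: B_def)
  have L0: "?L \<noteq> 0" using BL by (intro notI) simp
  have L1: "?L \<noteq> \<infinity>" using BL by (intro notI) (simp add: ennreal_mult_top split: if_splits)
  have "?R \<le> (\<integral>\<^sup>+s. ennreal (R ^ (N - 2)) * indicator {0..R} s \<partial>lborel)"
    by (intro nn_integral_mono) (auto simp: indicator_def intro!: ennreal_leI power_mono)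
  also have "\<dots> = ennreal (R ^ (N - 2)) * ennreal R" using R by (subst nn_integral_cmult_indicator) auto
  also have "\<dots> < \<infinity>" using R by (simp add: ennreal_mult_less_top)
  finally have R1: "?R \<noteq> \<infinity>" by simp
  have "0 < ennreal ((R/2) ^ (N - 2) * (R / 2))" using R by simp
  also have "\<dots> = ennreal ((R/2) ^ (N - 2)) * ennreal (R / 2)" using R by (subst ennreal_mult) auto
  also have "\<dots> = (\<integral>\<^sup>+s. ennreal ((R/2) ^ (N - 2)) * indicator {R/2..R} s \<partial>lborel)"
    using R by (subst nn_integral_cmult_indicator) auto
  also have "\<dots> \<le> ?R"
    using R by (intro nn_integral_mono) (auto simp: indicator_def intro!: ennreal_leI power_mono)
  finally have R0: "?R \<noteq> 0" by simp
  show "emeasure (leb N) (mc_cyl m' \<rho> N) \<noteq> 0" unfolding vol using R0 L0 by simp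
  show "emeasure (leb N) (mc_cyl m' \<rho> N) \<noteq> \<infinity>" unfolding vol using R1 L1 
    by (simp add: ennreal_mult_eq_top_iff)
qed

text \<open>The images of both measures under the projection agree on every set A, since the
  indicator of A at the projected point is affine invariant. Equality of the image measures carries
  over to real-valued \<open>g\<close> without integrability assumptions.\<close>

lemma mc_expect_eq_gauss:
  assumes "m'\<^sup>2 < \<rho>" and g[measurable]: "g \<in> borel_measurable (leb N)"
  shows "mc_expect m' \<rho> N g = (\<integral>x. g (mc_proj m' \<rho> N x) \<partial>Q)"
proof -
  let ?c = "emeasure (leb N) (mc_cyl m' \<rho> N)"
  let ?v = "measure (leb N) (mc_cyl m' \<rho> N)"
  let ?P = "density (leb N) (\<lambda>x. ennreal (indicator (mc_cyl m' \<rho> N) x / ?v))"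
  let ?p = "mc_proj m' \<rho> N"
  have cv: "?c = ennreal ?v" using emeasure_mc_cyl_pos_finite[OF assms(1)]
    by (intro emeasure_eq_ennreal_measure) auto
  have v: "?v > 0" using emeasure_mc_cyl_pos_finite[OF assms(1)] cv
    by (metis ennreal_0 less_le measure_nonneg)
  have "distr ?P (leb N) ?p = distr Q (leb N) ?p"
  proof (rule measure_eqI)
    fix A assume "A \<in> sets (distr ?P (leb N) ?p)"
    hence A[measurable]: "A \<in> sets (leb N)" by simp
    have G: "affine_invariant N (\<lambda>x. indicator A (?p x))"
      using two_le_N by unfold_locales (auto simp: mc_proj_affine)
    have "emeasure (distr ?P (leb N) ?p) A = (\<integral>\<^sup>+x. indicator A x \<partial>distr ?P (leb N) ?p)"
      by simp
    also have "\<dots> = (\<integral>\<^sup>+x. ennreal (indicator (mc_cyl m' \<rho> N) x / ?v) * indicator A (?p x) \<partial>leb N)"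
      by (subst nn_integral_distr, measurable, subst nn_integral_density) auto
    also have "\<dots> = (\<integral>\<^sup>+x. ennreal (1 / ?v) * (indicator A (?p x) * indicator (mc_cyl m' \<rho> N) x) \<partial>leb N)"
      by (intro nn_integral_cong) (auto simp: indicator_def)
    also have "\<dots> = ennreal (1 / ?v) * (ennreal ?v * (\<integral>\<^sup>+x. indicator A (?p x) \<partial>Q))"
      by (simp add: nn_integral_cmult nn_integral_mc_cyl[OF G] cv)
    also have "\<dots> = (\<integral>\<^sup>+x. indicator A (?p x) \<partial>Q)"
      using v by (subst mult.assoc[symmetric], subst ennreal_mult[symmetric]) auto
    also have "\<dots> = (\<integral>\<^sup>+x. indicator A x \<partial>distr Q (leb N) ?p)"
      by (subst nn_integral_distr) auto
    also have "\<dots> = emeasure (distr Q (leb N) ?p) A" by simp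
    finally show "emeasure (distr ?P (leb N) ?p) A = emeasure (distr Q (leb N) ?p) A" .
  qed auto
  hence "(\<integral>x. g x \<partial>distr ?P (leb N) ?p) = (\<integral>x. g x \<partial>distr Q (leb N) ?p)" by simp
  hence "(\<integral>x. g (?p x) \<partial>?P) = (\<integral>x. g (?p x) \<partial>Q)"
    by (simp add: integral_distr)
  moreover have "(\<integral>x. g (?p x) \<partial>?P) = (\<integral>x. indicator (mc_cyl m' \<rho> N) x * g (?p x) / ?v \<partial>leb N)"
    by (subst integral_density) auto
  ultimately show ?thesis unfolding mc_expect_def by simp
qed

lemma gc_expect_eq_gauss:
  assumes g[measurable]: "g \<in> borel_measurable (leb N)" and "\<eta> = 1 / (2 * \<sigma>\<^sup>2)" and "\<mu> = - m / \<sigma>\<^sup>2"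
  shows "gc_expect \<mu> \<eta> N g = (\<integral>x. g x \<partial>Q)"
proof -
  let ?d = "\<lambda>x. \<Prod>i<N. normal_density m \<sigma> (x i)"
  \<comment> \<open>K collects exp(N m^2 / (2 \<sigma>^2)), left over from completing the square,
    and the inverse of the Gaussian normalization; it cancels in the quotient that defines
    \<open>gc_expect\<close>.\<close>
  define K where "K = exp (real N * m\<^sup>2 / (2 * \<sigma>\<^sup>2)) / (1 / sqrt (2 * pi * \<sigma>\<^sup>2)) ^ N"
  have K: "K > 0" using \<sigma>_pos by (simp add: K_def)
  have e: "exp (- \<mu> * (\<Sum>i<N. x i) - \<eta> * (\<Sum>i<N. (x i)\<^sup>2)) = K * ?d x" for x :: "nat \<Rightarrow> real"
  proof -
    have "(\<Sum>i<N. (x i - m)\<^sup>2) = (\<Sum>i<N. (x i)\<^sup>2) - 2 * m * (\<Sum>i<N. x i) + real N * m\<^sup>2"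
      by (simp add: power2_diff sum.distrib sum_subtractf sum_distrib_left mult_ac)
    hence "- \<mu> * (\<Sum>i<N. x i) - \<eta> * (\<Sum>i<N. (x i)\<^sup>2) = real N * m\<^sup>2 / (2 * \<sigma>\<^sup>2) + (- (\<Sum>i<N. (x i - m)\<^sup>2) / (2 * \<sigma>\<^sup>2))"
      using \<sigma>_pos by (simp add: assms(2,3) field_simps)
    moreover have "1 / sqrt (2 * pi * \<sigma>\<^sup>2) > 0" using \<sigma>_pos by simp
    ultimately show ?thesis
      using \<sigma>_pos by (simp add: prod_normal_density K_def exp_add[symmetric])
  qed
  have gd: "(\<integral>x. h x \<partial>Q) = (\<integral>x. ?d x * h x \<partial>leb N)" if [measurable]: "h \<in> borel_measurable (leb N)" for h :: "_ \<Rightarrow> real"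
    unfolding gauss_eq_density[OF \<sigma>_pos] by (subst integral_density) (auto intro!: AE_I2 prod_nonneg)
  have "(\<integral>x. ?d x \<partial>leb N) = 1" using gd[of "\<lambda>_. 1"] prob_space by simp
  moreover have "(\<integral>x. g x * (K * ?d x) \<partial>leb N) = K * (\<integral>x. g x \<partial>Q)"
    by (subst gd) (auto simp: mult_ac)
  ultimately show ?thesis unfolding gc_expect_def e using K by simp
qed

end

section \<open>Moments\<close>

lemma power_even_add_le:
  fixes a b :: real
  shows "(a + b) ^ (2 * q) \<le> 2 ^ (2 * q) * (a ^ (2 * q) + b ^ (2 * q))"
proof -
  let ?M = "max \<bar>a\<bar> \<bar>b\<bar>"
  have "(a + b) ^ (2 * q) = \<bar>a + b\<bar> ^ (2 * q)" by (simp add: power_even_abs)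
  also have "\<dots> \<le> (2 * ?M) ^ (2 * q)" by (intro power_mono) auto
  also have "\<dots> = 2 ^ (2 * q) * ?M ^ (2 * q)" by (simp add: power_mult_distrib)
  also have "?M ^ (2 * q) \<le> a ^ (2 * q) + b ^ (2 * q)"
  proof -
    have "\<bar>a\<bar> ^ (2 * q) = a ^ (2 * q)" "\<bar>b\<bar> ^ (2 * q) = b ^ (2 * q)"
      by (simp_all add: power_even_abs)
    moreover have "0 \<le> a ^ (2 * q)" "0 \<le> b ^ (2 * q)" by simp_all
    ultimately show ?thesis by (auto simp: max_def)
  qed
  finally show ?thesis by simp
qed

text \<open>Jensen's inequality for the convex function t^(2q) with weights 1/N.\<close>

lemma power_mean_even:
  fixes y :: "nat \<Rightarrow> real"
  assumes "N > 0"
  shows "((\<Sum>i<N. y i) / real N) ^ (2 * q) \<le> (\<Sum>i<N. y i ^ (2 * q)) / real N"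
proof -
  have "(\<Sum>i<N. (1 / real N) *\<^sub>R y i) ^ (2 * q) \<le> (\<Sum>i<N. 1 / real N * y i ^ (2 * q))"
    using assms by (intro convex_on_sum[OF _ _ convex_power_even[of "2 * q"]]) auto
  thus ?thesis by (simp add: sum_divide_distrib)
qed

lemma integrable_dominated:
  fixes f g :: "'a \<Rightarrow> real"
  assumes "integrable M g" "f \<in> borel_measurable M" "\<And>x. x \<in> space M \<Longrightarrow> 0 \<le> f x" "\<And>x. x \<in> space M \<Longrightarrow> f x \<le> g x"
  shows "integrable M f" "(\<integral>x. f x \<partial>M) \<le> (\<integral>x. g x \<partial>M)"
proof -
  show i: "integrable M f"
    using assms by (intro Bochner_Integration.integrable_bound[OF assms(1,2)] AE_I2) (force)
  show "(\<integral>x. f x \<partial>M) \<le> (\<integral>x. g x \<partial>M)"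
    using assms i by (intro integral_mono) auto
qed

text \<open>The central moment of order 2q of a normal variable, (2q - 1)!! \<sigma>^(2q).\<close>

definition normal_moment :: "real \<Rightarrow> nat \<Rightarrow> real" where
  "normal_moment \<sigma> q = fact (2 * q) / ((2 / \<sigma>\<^sup>2) ^ q * fact q)"

context gaussian_vector
begin

abbreviation n1 where "n1 \<equiv> density lborel (\<lambda>x. ennreal (normal_density m \<sigma> x))"

lemma prod_space: "product_prob_space (\<lambda>_::nat. n1)"
  by (intro product_prob_spaceI prob_space_normal)

lemma random_variable_coord: "i < N \<Longrightarrow> random_variable borel (\<lambda>x. x i)"
  by (subst measurable_cong_sets[OF sets_gauss refl]) (rule measurable_coord)

lemma coord:
  fixes h :: "real \<Rightarrow> real"
  assumes "i < N" and [measurable]: "h \<in> borel_measurable borel"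
  shows "integrable Q (\<lambda>x. h (x i)) \<longleftrightarrow> integrable lborel (\<lambda>y. normal_density m \<sigma> y * h y)"
    and "(\<integral>x. h (x i) \<partial>Q) = (\<integral>y. normal_density m \<sigma> y * h y \<partial>lborel)"
proof -
  have d: "distr Q n1 (\<lambda>x. x i) = n1"
    unfolding gauss_def using assms(1) by (intro distr_PiM_component prob_space_normal) auto
  note [measurable] = random_variable_coord[OF assms(1)]
  have [measurable]: "(\<lambda>x. x i) \<in> Q \<rightarrow>\<^sub>M n1"
    unfolding gauss_def using assms(1) by (intro measurable_component_singleton) simp
  have "integrable Q (\<lambda>x. h (x i)) \<longleftrightarrow> integrable (distr Q n1 (\<lambda>x. x i)) h"
    by (subst integrable_distr_eq) auto
  also have "\<dots> \<longleftrightarrow> integrable lborel (\<lambda>y. normal_density m \<sigma> y * h y)"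
    unfolding d by (subst integrable_density) auto
  finally show "integrable Q (\<lambda>x. h (x i)) \<longleftrightarrow> integrable lborel (\<lambda>y. normal_density m \<sigma> y * h y)" .
  have "(\<integral>x. h (x i) \<partial>Q) = (\<integral>y. h y \<partial>distr Q n1 (\<lambda>x. x i))"
    by (subst integral_distr) auto
  also have "\<dots> = (\<integral>y. normal_density m \<sigma> y * h y \<partial>lborel)"
    unfolding d by (subst integral_density) auto
  finally show "(\<integral>x. h (x i) \<partial>Q) = (\<integral>y. normal_density m \<sigma> y * h y \<partial>lborel)" .
qed

lemma integrable_coord_power: "i < N \<Longrightarrow> integrable Q (\<lambda>x. (x i - m) ^ k)"
  using coord(1)[of i "\<lambda>y. (y - m) ^ k"] integrable_normal_moment[OF \<sigma>_pos, of m k] by simp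

lemma expectation_coord_even: "i < N \<Longrightarrow> (\<integral>x. (x i - m) ^ (2 * q) \<partial>Q) = normal_moment \<sigma> q"
  using coord(2)[of i "\<lambda>y. (y - m) ^ (2 * q)"] integral_normal_moment_even[OF \<sigma>_pos, of m q]
  by (simp add: normal_moment_def)

lemma expectation_coord: "i < N \<Longrightarrow> (\<integral>x. (x i - m) \<partial>Q) = 0"
  using coord(2)[of i "\<lambda>y. (y - m)"] integral_normal_moment_odd[OF \<sigma>_pos, of m 0] by simp

lemma normal_moment_nonneg: "normal_moment \<sigma> q \<ge> 0"
  by (simp add: normal_moment_def)

lemma normal_moment_1: "normal_moment \<sigma> 1 = \<sigma>\<^sup>2"
  using \<sigma>_pos by (simp add: normal_moment_def)

lemma normal_moment_2: "normal_moment \<sigma> 2 = 3 * \<sigma> ^ 4"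
  using \<sigma>_pos by (simp add: normal_moment_def fact_numeral power_divide)

text \<open>Distinct coordinates are independent and h is centred, so the off-diagonal terms of the
  expanded square integrate to zero.\<close>

lemma expectation_sum_square:
  fixes h :: "real \<Rightarrow> real"
  assumes [measurable]: "h \<in> borel_measurable borel"
    and int: "\<And>i. i < N \<Longrightarrow> integrable Q (\<lambda>x. h (x i))"
    and int2: "\<And>i. i < N \<Longrightarrow> integrable Q (\<lambda>x. (h (x i))\<^sup>2)"
    and zero: "\<And>i. i < N \<Longrightarrow> (\<integral>x. h (x i) \<partial>Q) = 0"
    and var: "\<And>i. i < N \<Longrightarrow> (\<integral>x. (h (x i))\<^sup>2 \<partial>Q) = v"
  shows "integrable Q (\<lambda>x. (\<Sum>i<N. h (x i))\<^sup>2)" "(\<integral>x. (\<Sum>i<N. h (x i))\<^sup>2 \<partial>Q) = real N * v"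
proof -
  interpret p: product_prob_space "\<lambda>_::nat. n1" by (rule prod_space)
  have one: "integrable n1 (\<lambda>_. 1::real)" by (simp add: prob_space.finite_measure[OF prob_space_normal])
  have sq: "(\<Sum>i<N. h (x i))\<^sup>2 = (\<Sum>i<N. \<Sum>j<N. h (x i) * h (x j))" for x
    by (simp add: power2_eq_square sum_product)
  have cross: "integrable Q (\<lambda>x. h (x i) * h (x j)) \<and> (\<integral>x. h (x i) * h (x j) \<partial>Q) = (if i = j then v else 0)"
    if ij: "i < N" "j < N" for i j
  proof (cases "i = j")
    case True
    thus ?thesis using int2[OF ij(1)] var[OF ij(1)] by (simp add: power2_eq_square)
  next
    case False
    have h1: "integrable n1 h"
      using int[OF ij(1)] by (simp add: coord(1)[OF ij(1)] integrable_density)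
    have h0: "(\<integral>y. h y \<partial>n1) = 0"
      using zero[OF ij(1)] by (simp add: coord(2)[OF ij(1)] integral_density)
    \<comment> \<open>The product of two coordinate functions becomes a product over all
      coordinates, with the factor 1 elsewhere, so that the integral factors.\<close>
    let ?f = "\<lambda>k y. if k = i \<or> k = j then h y else 1"
    have f: "integrable n1 (?f k)" for k using h1 one by (cases "k = i \<or> k = j") simp_all
    have eq: "(\<Prod>k<N. ?f k (x k)) = h (x i) * h (x j)" for x
    proof -
      have "(\<Prod>k<N. ?f k (x k)) = (\<Prod>k\<in>{i, j}. ?f k (x k))"
        using ij by (intro prod.mono_neutral_right) auto
      thus ?thesis using False by simp
    qed
    have "integrable Q (\<lambda>x. \<Prod>k<N. ?f k (x k))"
      unfolding gauss_def by (intro p.product_integrable_prod f) simp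
    moreover have "(\<integral>x. (\<Prod>k<N. ?f k (x k)) \<partial>Q) = (\<Prod>k<N. integral\<^sup>L n1 (?f k))"
      unfolding gauss_def by (intro p.product_integral_prod f) simp
    moreover have "(\<Prod>k<N. integral\<^sup>L n1 (?f k)) = 0"
      using ij h0 by (intro prod_zero bexI[of _ i]) auto
    ultimately show ?thesis unfolding eq using False by simp
  qed
  show "integrable Q (\<lambda>x. (\<Sum>i<N. h (x i))\<^sup>2)"
    unfolding sq using cross by (intro Bochner_Integration.integrable_sum) auto
  have "(\<integral>x. (\<Sum>i<N. h (x i))\<^sup>2 \<partial>Q) = (\<Sum>i<N. \<Sum>j<N. if i = j then v else 0)"
    unfolding sq using cross
    by (subst Bochner_Integration.integral_sum; (intro Bochner_Integration.integrable_sum sum.cong refl)?; (subst Bochner_Integration.integral_sum)?; auto)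
  thus "(\<integral>x. (\<Sum>i<N. h (x i))\<^sup>2 \<partial>Q) = real N * v" by simp
qed

abbreviation B where "B \<equiv> \<lambda>x. vmean N x - m"

lemma B_eq: "B x = (\<Sum>i<N. x i - m) / real N"
  using N_pos by (simp add: vmean_def sum_subtractf diff_divide_distrib)

lemma B_square: "integrable Q (\<lambda>x. (B x)\<^sup>2)" "(\<integral>x. (B x)\<^sup>2 \<partial>Q) = \<sigma>\<^sup>2 / real N"
proof -
  have *: "integrable Q (\<lambda>x. (\<Sum>i<N. x i - m)\<^sup>2)" "(\<integral>x. (\<Sum>i<N. x i - m)\<^sup>2 \<partial>Q) = real N * \<sigma>\<^sup>2"
    using expectation_sum_square[of "\<lambda>y. y - m" "\<sigma>\<^sup>2"] integrable_coord_power[of _ 1] integrable_coord_power[of _ 2]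
      expectation_coord expectation_coord_even[of _ 1] normal_moment_1 by auto
  show "integrable Q (\<lambda>x. (B x)\<^sup>2)" unfolding B_eq power_divide using *(1) by simp
  show "(\<integral>x. (B x)\<^sup>2 \<partial>Q) = \<sigma>\<^sup>2 / real N"
    unfolding B_eq power_divide using *(2) N_pos by (simp add: power2_eq_square)
qed

text \<open>A bound uniform in N suffices here, and Jensen's inequality gives it at once; the decay
  1/N is needed only for the second moment, in \<open>B_square\<close>.\<close>

lemma B_moment: "integrable Q (\<lambda>x. (B x) ^ (2 * q))" "(\<integral>x. (B x) ^ (2 * q) \<partial>Q) \<le> normal_moment \<sigma> q"
proof -
  let ?g = "\<lambda>x. (\<Sum>i<N. (x i - m) ^ (2 * q)) / real N"
  have g: "integrable Q ?g" by (intro Bochner_Integration.integrable_divide Bochner_Integration.integrable_sum integrable_coord_power) auto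
  have gi: "(\<integral>x. ?g x \<partial>Q) = normal_moment \<sigma> q"
    using N_pos by (simp add: Bochner_Integration.integral_sum integrable_coord_power expectation_coord_even)
  have le: "(B x) ^ (2 * q) \<le> ?g x" for x unfolding B_eq by (rule power_mean_even[OF N_pos])
  show "integrable Q (\<lambda>x. (B x) ^ (2 * q))" "(\<integral>x. (B x) ^ (2 * q) \<partial>Q) \<le> normal_moment \<sigma> q"
    using integrable_dominated[OF g, of "\<lambda>x. (B x) ^ (2 * q)"] le gi by auto
qed

text \<open>The summands (x_i - m)^2 - \<sigma>^2 are independent and centred, with variance 3
  \<sigma>^4 - \<sigma>^4 = 2 \<sigma>^4.\<close>

lemma sum_fluctuation:
  "integrable Q (\<lambda>x. ((\<Sum>i<N. (x i - m)\<^sup>2) - real N * \<sigma>\<^sup>2)\<^sup>2)"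
  "(\<integral>x. ((\<Sum>i<N. (x i - m)\<^sup>2) - real N * \<sigma>\<^sup>2)\<^sup>2 \<partial>Q) = real N * (2 * \<sigma> ^ 4)"
proof -
  let ?h = "\<lambda>y. (y - m)\<^sup>2 - \<sigma>\<^sup>2"
  have sq: "(?h y)\<^sup>2 = (y - m) ^ 4 - 2 * \<sigma>\<^sup>2 * (y - m) ^ 2 + \<sigma> ^ 4" for y :: real
  proof -
    have "(z - s)\<^sup>2 = z\<^sup>2 - 2 * s * z + s\<^sup>2" for z s :: real
      by (simp add: power2_eq_square algebra_simps)
    from this[of "(y - m)\<^sup>2" "\<sigma>\<^sup>2"] show ?thesis by (simp add: power_mult[symmetric])
  qed
  note i2 = integrable_coord_power[of _ 2] and i4 = integrable_coord_power[of _ 4]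
  have e2: "(\<integral>x. (x i - m)\<^sup>2 \<partial>Q) = \<sigma>\<^sup>2" if "i < N" for i
    using expectation_coord_even[OF that, of 1] normal_moment_1 by simp
  have e4: "(\<integral>x. (x i - m) ^ 4 \<partial>Q) = 3 * \<sigma> ^ 4" if "i < N" for i
    using expectation_coord_even[OF that, of 2] normal_moment_2 by simp
  have ss: "2 * \<sigma>\<^sup>2 * \<sigma>\<^sup>2 = 2 * \<sigma> ^ 4" by (simp add: power_add[symmetric])
  have eq: "(\<Sum>i<N. ?h (x i)) = (\<Sum>i<N. (x i - m)\<^sup>2) - real N * \<sigma>\<^sup>2" for x
    by (simp add: sum_subtractf)
  have 1: "integrable Q (\<lambda>x. ?h (x i))" if "i < N" for i using i2[OF that] by simp
  have 2: "integrable Q (\<lambda>x. (?h (x i))\<^sup>2)" if "i < N" for i unfolding sq using i2[OF that] i4[OF that] by simp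
  have 3: "(\<integral>x. ?h (x i) \<partial>Q) = 0" if "i < N" for i using i2[OF that] e2[OF that] by simp
  have 4: "(\<integral>x. (?h (x i))\<^sup>2 \<partial>Q) = 2 * \<sigma> ^ 4" if "i < N" for i
    unfolding sq using i2[OF that] i4[OF that] e2[OF that] e4[OF that] ss by simp
  show "integrable Q (\<lambda>x. ((\<Sum>i<N. (x i - m)\<^sup>2) - real N * \<sigma>\<^sup>2)\<^sup>2)"
    using expectation_sum_square(1)[of ?h "2 * \<sigma> ^ 4", OF _ 1 2 3 4] by (simp add: eq)
  show "(\<integral>x. ((\<Sum>i<N. (x i - m)\<^sup>2) - real N * \<sigma>\<^sup>2)\<^sup>2 \<partial>Q) = real N * (2 * \<sigma> ^ 4)"
    using expectation_sum_square(2)[of ?h "2 * \<sigma> ^ 4", OF _ 1 2 3 4] by (simp add: eq)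
qed

text \<open>The mean uses up one of the N degrees of freedom: N E[B^2] = \<sigma>^2 is subtracted
  from N \<sigma>^2.\<close>

lemma V_square: "integrable Q (\<lambda>x. (V x)\<^sup>2)" "(\<integral>x. (V x)\<^sup>2 \<partial>Q) = (real N - 1) * \<sigma>\<^sup>2"
proof -
  have eq: "(V x)\<^sup>2 = (\<Sum>i<N. (x i - m)\<^sup>2) - real N * (B x)\<^sup>2" for x
    using sum_square_decompose[OF N_pos, of x m] by simp
  have e2: "(\<integral>x. (x i - m)\<^sup>2 \<partial>Q) = \<sigma>\<^sup>2" if "i < N" for i
    using expectation_coord_even[OF that, of 1] normal_moment_1 by simp
  have s: "integrable Q (\<lambda>x. \<Sum>i<N. (x i - m)\<^sup>2)"
    by (intro Bochner_Integration.integrable_sum integrable_coord_power) auto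
  have si: "(\<integral>x. (\<Sum>i<N. (x i - m)\<^sup>2) \<partial>Q) = real N * \<sigma>\<^sup>2"
    by (subst Bochner_Integration.integral_sum) (auto simp: integrable_coord_power e2)
  show "integrable Q (\<lambda>x. (V x)\<^sup>2)" unfolding eq using s B_square(1) by simp
  show "(\<integral>x. (V x)\<^sup>2 \<partial>Q) = (real N - 1) * \<sigma>\<^sup>2"
    unfolding eq using s B_square si N_pos by (simp add: algebra_simps)
qed

text \<open>Both sqrt N \<sigma> and V are compared with the distance A of x from (m, ..., m). By
  Pythagoras |A - V| \<le> sqrt N |B|, while A^2 - N \<sigma>^2 is the fluctuation
  \<open>?T\<close>; both differences stay bounded in mean square.\<close>

lemma V_fluctuation:
  "integrable Q (\<lambda>x. (sqrt (real N) * \<sigma> - V x)\<^sup>2)"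
  "(\<integral>x. (sqrt (real N) * \<sigma> - V x)\<^sup>2 \<partial>Q) \<le> 6 * \<sigma>\<^sup>2"
proof -
  let ?T = "\<lambda>x. (\<Sum>i<N. (x i - m)\<^sup>2) - real N * \<sigma>\<^sup>2"
  \<comment> \<open>The two terms have expectations 2 \<sigma>^2 and 4 \<sigma>^2, which add up to 6
    \<sigma>^2.\<close>
  let ?g = "\<lambda>x. 2 * real N * (B x)\<^sup>2 + 2 / (real N * \<sigma>\<^sup>2) * (?T x)\<^sup>2"
  have g: "integrable Q ?g" using B_square(1) sum_fluctuation(1) by simp
  have "(\<integral>x. ?g x \<partial>Q) = 2 * \<sigma>\<^sup>2 + 2 / (real N * \<sigma>\<^sup>2) * (real N * (2 * \<sigma> ^ 4))"
    using B_square sum_fluctuation N_pos by simp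
  also have "\<dots> = 6 * \<sigma>\<^sup>2" using N_pos \<sigma>_pos by (simp add: field_simps power_numeral_reduce)
  finally have gi: "(\<integral>x. ?g x \<partial>Q) = 6 * \<sigma>\<^sup>2" .
  have le: "(sqrt (real N) * \<sigma> - V x)\<^sup>2 \<le> ?g x" for x
  proof -
    define A where "A = sqrt (\<Sum>i<N. (x i - m)\<^sup>2)"
    define R where "R = sqrt (real N) * \<sigma>"
    have R: "R > 0" "R\<^sup>2 = real N * \<sigma>\<^sup>2" using N_pos \<sigma>_pos by (auto simp: R_def power_mult_distrib)
    have A: "A \<ge> 0" "A\<^sup>2 = (\<Sum>i<N. (x i - m)\<^sup>2)" by (auto simp: A_def sum_nonneg)
    have A2: "A\<^sup>2 = (V x)\<^sup>2 + (sqrt (real N) * \<bar>B x\<bar>)\<^sup>2"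
      unfolding A(2) using sum_square_decompose[OF N_pos, of x m] by (simp add: power_mult_distrib)
    have "A \<le> V x + sqrt (real N) * \<bar>B x\<bar>"
      by (rule power2_le_imp_le) (simp_all add: A2 power2_sum)
    moreover have "V x \<le> A" using A(1) by (intro power2_le_imp_le[of "V x" A]) (simp_all add: A2)
    ultimately have "(A - V x)\<^sup>2 \<le> (sqrt (real N) * \<bar>B x\<bar>)\<^sup>2" by (intro power_mono) auto
    hence 1: "(A - V x)\<^sup>2 \<le> real N * (B x)\<^sup>2" by (simp add: power_mult_distrib)
    \<comment> \<open>In R^2 - A^2 = (R - A)(R + A) the second factor is at least R, so |R - A| is
      at most |\<open>?T x\<close>| / R, also when A is small.\<close>
    have "R\<^sup>2 * (R - A)\<^sup>2 \<le> (R + A)\<^sup>2 * (R - A)\<^sup>2"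
      using R A by (intro mult_right_mono power_mono) auto
    also have "\<dots> = (A\<^sup>2 - R\<^sup>2)\<^sup>2" by (simp add: power2_eq_square algebra_simps)
    finally have 2: "(R - A)\<^sup>2 \<le> (?T x)\<^sup>2 / (real N * \<sigma>\<^sup>2)"
      using R(1) by (simp add: A(2) R(2)[symmetric] pos_le_divide_eq mult.commute)
    have "(R - V x)\<^sup>2 \<le> 2 * (A - V x)\<^sup>2 + 2 * (R - A)\<^sup>2"
      using zero_le_power2[of "(A - V x) - (R - A)"] by (simp add: power2_eq_square algebra_simps)
    also have "\<dots> \<le> ?g x" using 1 2 by simp
    finally show ?thesis by (simp only: R_def)
  qed
  show "integrable Q (\<lambda>x. (sqrt (real N) * \<sigma> - V x)\<^sup>2)"
    "(\<integral>x. (sqrt (real N) * \<sigma> - V x)\<^sup>2 \<partial>Q) \<le> 6 * \<sigma>\<^sup>2"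
    using integrable_dominated[OF g, of "\<lambda>x. (sqrt (real N) * \<sigma> - V x)\<^sup>2"] le gi by auto
qed

text \<open>The deviation is the difference of x_i - m and B, each with a moment of order 2q of at
  most \<open>normal_moment \<sigma> q\<close>; hence the factor 2.\<close>

lemma D_moment:
  assumes i: "i < N"
  shows "integrable Q (\<lambda>x. (vdev N x i) ^ (2 * q))"
    "(\<integral>x. (vdev N x i) ^ (2 * q) \<partial>Q) \<le> 2 ^ (2 * q) * (2 * normal_moment \<sigma> q)"
proof -
  let ?g = "\<lambda>x. 2 ^ (2 * q) * ((x i - m) ^ (2 * q) + (B x) ^ (2 * q))"
  have g: "integrable Q ?g" using integrable_coord_power[OF i] B_moment(1) by simp
  have gi: "(\<integral>x. ?g x \<partial>Q) \<le> 2 ^ (2 * q) * (2 * normal_moment \<sigma> q)"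
    using integrable_coord_power[OF i] B_moment[of q] expectation_coord_even[OF i] by simp
  have le: "(vdev N x i) ^ (2 * q) \<le> ?g x" for x
    using power_even_add_le[of "x i - m" "- B x" q] i
    by (simp add: vdev_def power_mult power2_commute[of m])
  note dom = integrable_dominated[OF g, of "\<lambda>x. (vdev N x i) ^ (2 * q)"]
  show "integrable Q (\<lambda>x. (vdev N x i) ^ (2 * q))" using dom(1) le i by simp
  have "(\<integral>x. (vdev N x i) ^ (2 * q) \<partial>Q) \<le> (\<integral>x. ?g x \<partial>Q)" using dom(2) le i by simp
  also note gi
  finally show "(\<integral>x. (vdev N x i) ^ (2 * q) \<partial>Q) \<le> 2 ^ (2 * q) * (2 * normal_moment \<sigma> q)" .
qed

section \<open>Direction and length of the deviation vector\<close>

abbreviation U where "U \<equiv> \<lambda>i x. vdev N x i / V x"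

lemma vdev_square_le: "i < N \<Longrightarrow> (vdev N x i)\<^sup>2 \<le> (V x)\<^sup>2"
  using member_le_sum[of i "{..<N}" "\<lambda>i. (vdev N x i)\<^sup>2"] by (simp add: vnorm_def sum_nonneg)

text \<open>At V = 0 the quotient \<open>U\<close> is 0 by convention, and the identity persists
  because all deviations vanish there.\<close>

lemma vdev_eq_U: "i < N \<Longrightarrow> vdev N x i = U i x * V x"
  using vdev_square_le[of i x] by (cases "V x = 0") auto

lemma U_power_le_1: "i < N \<Longrightarrow> (U i x) ^ (2 * q) \<le> 1"
  using vdev_square_le[of i x]
  by (cases "V x = 0") (auto simp: power_mult power_divide divide_le_eq_1 intro!: power_mono power_le_one)

lemma affine_invariant_U:
  assumes i: "i < N" shows "affine_invariant N (\<lambda>x. ennreal ((U i x) ^ (2 * q)))"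
proof
  show "(\<lambda>x. ennreal ((U i x) ^ (2 * q))) \<in> borel_measurable (leb N)" using i by measurable
  show "ennreal ((U i (affine_coords N t c x)) ^ (2 * q)) = ennreal ((U i x) ^ (2 * q))" if "c > 0" for t c x
    using that i N_pos by (simp add: vdev_affine vnorm_vdev_affine)
qed (rule two_le_N)

lemma integrable_U:
  assumes i: "i < N" shows "integrable Q (\<lambda>x. (U i x) ^ (2 * q))"
proof (rule integrable_dominated(1))
  show "integrable Q (\<lambda>_. 1::real)" by simp
  show "(\<lambda>x. (U i x) ^ (2 * q)) \<in> borel_measurable Q" using i by measurable
  show "(U i x) ^ (2 * q) \<le> 1" for x by (rule U_power_le_1[OF i])
qed simp

text \<open>Jensen's inequality for t^q at t = V^2, through the tangent line at c = E[V^2];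
  Bernoulli's inequality puts the power above that line. In \<open>ennreal\<close> the moment need
  not be known to be finite.\<close>

lemma nn_integral_V_power_ge:
  "ennreal (((real N - 1) * \<sigma>\<^sup>2) ^ q) \<le> (\<integral>\<^sup>+x. ennreal ((V x) ^ (2 * q)) \<partial>Q)"
proof -
  define c where "c = (real N - 1) * \<sigma>\<^sup>2"
  have c: "c > 0" using two_le_N \<sigma>_pos by (simp add: c_def)
  let ?f = "\<lambda>x. c ^ q * (1 + real q * ((V x)\<^sup>2 / c - 1))"
  have f: "integrable Q ?f" using V_square(1) by simp
  have fc: "(\<integral>x. ?f x \<partial>Q) = c ^ q"
    using V_square c prob_space by (simp add: c_def[symmetric])
  \<comment> \<open>The tangent line can be negative for small V; it is cut off at 0 before passing
    to the nonnegative integral.\<close>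
  have "(\<integral>x. ?f x \<partial>Q) \<le> (\<integral>x. max 0 (?f x) \<partial>Q)"
    using f by (intro integral_mono) auto
  hence "ennreal (c ^ q) \<le> ennreal (\<integral>x. max 0 (?f x) \<partial>Q)"
    by (intro ennreal_leI order_trans[OF eq_refl[OF fc[symmetric]]])
  also have "\<dots> = (\<integral>\<^sup>+x. ennreal (max 0 (?f x)) \<partial>Q)"
    using f by (intro nn_integral_eq_integral[symmetric]) auto
  also have "\<dots> \<le> (\<integral>\<^sup>+x. ennreal ((V x) ^ (2 * q)) \<partial>Q)"
  proof (intro nn_integral_mono ennreal_leI)
    fix x
    have "1 + real q * ((V x)\<^sup>2 / c - 1) \<le> (1 + ((V x)\<^sup>2 / c - 1)) ^ q"
      using c by (intro Bernoulli_inequality) simp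
    hence "?f x \<le> c ^ q * ((V x)\<^sup>2 / c) ^ q" using c by (intro mult_left_mono) auto
    also have "\<dots> = (V x) ^ (2 * q)" using c by (simp add: power_divide power_mult)
    finally show "max 0 (?f x) \<le> (V x) ^ (2 * q)" by simp
  qed
  finally show ?thesis by (simp only: c_def)
qed

text \<open>The deviation is U V, and independence splits its moment into a product. Dividing by the
  lower bound for E[V^(2q)] leaves an expectation of order N^(-q).\<close>

lemma U_moment:
  assumes i: "i < N"
  shows "(\<integral>x. (U i x) ^ (2 * q) \<partial>Q) \<le> 2 ^ (2 * q) * (2 * normal_moment \<sigma> q) / ((real N - 1) * \<sigma>\<^sup>2) ^ q"
proof -
  define c where "c = ((real N - 1) * \<sigma>\<^sup>2) ^ q"
  have c: "c > 0" using two_le_N \<sigma>_pos by (simp add: c_def)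
  let ?u = "\<integral>x. (U i x) ^ (2 * q) \<partial>Q"
  have u: "(\<integral>\<^sup>+x. ennreal ((U i x) ^ (2 * q)) \<partial>Q) = ennreal ?u"
    by (intro nn_integral_eq_integral integrable_U i AE_I2) simp
  have u0: "?u \<ge> 0" by (intro integral_nonneg_AE AE_I2) simp
  have "ennreal (?u * c) = ennreal ?u * ennreal c" using u0 c by (simp add: ennreal_mult)
  also have "\<dots> \<le> ennreal ?u * (\<integral>\<^sup>+x. ennreal ((V x) ^ (2 * q)) \<partial>Q)"
    unfolding c_def by (intro mult_left_mono nn_integral_V_power_ge) simp
  also have "\<dots> = (\<integral>\<^sup>+x. ennreal ((U i x) ^ (2 * q)) * ennreal ((V x) ^ (2 * q)) \<partial>Q)"
    using nn_integral_gauss_independent[OF affine_invariant_U[OF i], of "\<lambda>v. ennreal (v ^ (2 * q))"]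
    by (simp add: u)
  also have "\<dots> = (\<integral>\<^sup>+x. ennreal ((vdev N x i) ^ (2 * q)) \<partial>Q)"
  proof (rule nn_integral_cong)
    fix x
    have "vdev N x i ^ (2 * q) = (U i x) ^ (2 * q) * (V x) ^ (2 * q)"
      by (subst vdev_eq_U[OF i]) (rule power_mult_distrib)
    thus "ennreal ((U i x) ^ (2 * q)) * ennreal ((V x) ^ (2 * q)) = ennreal ((vdev N x i) ^ (2 * q))"
      by (simp only:) (simp add: ennreal_mult)
  qed
  also have "\<dots> = ennreal (\<integral>x. (vdev N x i) ^ (2 * q) \<partial>Q)"
    by (intro nn_integral_eq_integral D_moment i AE_I2) simp
  also have "\<dots> \<le> ennreal (2 ^ (2 * q) * (2 * normal_moment \<sigma> q))"
    by (intro ennreal_leI D_moment i)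
  finally have "?u * c \<le> 2 ^ (2 * q) * (2 * normal_moment \<sigma> q)"
    by (subst (asm) ennreal_le_iff) (auto simp: normal_moment_nonneg)
  thus ?thesis using c by (simp add: c_def pos_le_divide_eq)
qed

text \<open>Independence applies also to the weight (sqrt N \<sigma> - v)^2: the factor of the
  direction is O(1/N), that of the length is bounded.\<close>

lemma U_fluctuation:
  assumes i: "i < N"
  shows "integrable Q (\<lambda>x. (U i x)\<^sup>2 * (sqrt (real N) * \<sigma> - V x)\<^sup>2)"
    "(\<integral>x. (U i x)\<^sup>2 * (sqrt (real N) * \<sigma> - V x)\<^sup>2 \<partial>Q) \<le> 96 * \<sigma>\<^sup>2 / real N"
proof -
  let ?w = "\<lambda>v. (sqrt (real N) * \<sigma> - v)\<^sup>2"
  let ?u = "\<integral>x. (U i x)\<^sup>2 \<partial>Q"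
  show int: "integrable Q (\<lambda>x. (U i x)\<^sup>2 * ?w (V x))"
  proof (rule integrable_dominated(1)[OF V_fluctuation(1)])
    show "(\<lambda>x. (U i x)\<^sup>2 * ?w (V x)) \<in> borel_measurable Q" using i by measurable
    show "(U i x)\<^sup>2 * ?w (V x) \<le> ?w (V x)" for x
      using U_power_le_1[OF i, of x 1] by (intro mult_left_le_one_le) auto
  qed simp
  have "ennreal (\<integral>x. (U i x)\<^sup>2 * ?w (V x) \<partial>Q) = (\<integral>\<^sup>+x. ennreal ((U i x)\<^sup>2 * ?w (V x)) \<partial>Q)"
    by (intro nn_integral_eq_integral[symmetric] int AE_I2) simp
  also have "\<dots> = (\<integral>\<^sup>+x. ennreal ((U i x) ^ (2 * 1)) * ennreal (?w (V x)) \<partial>Q)"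
    by (intro nn_integral_cong) (simp add: ennreal_mult)
  also have "\<dots> = (\<integral>\<^sup>+x. ennreal ((U i x) ^ (2 * 1)) \<partial>Q) * (\<integral>\<^sup>+x. ennreal (?w (V x)) \<partial>Q)"
    by (rule nn_integral_gauss_independent[OF affine_invariant_U[OF i]]) measurable
  also have "\<dots> = ennreal ?u * ennreal (\<integral>x. ?w (V x) \<partial>Q)"
    using integrable_U[OF i, of 1] V_fluctuation(1) by (simp add: nn_integral_eq_integral)
  also have "\<dots> = ennreal (?u * (\<integral>x. ?w (V x) \<partial>Q))"
    by (intro ennreal_mult[symmetric] integral_nonneg_AE AE_I2) simp_all
  finally have "(\<integral>x. (U i x)\<^sup>2 * ?w (V x) \<partial>Q) = ?u * (\<integral>x. ?w (V x) \<partial>Q)"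
    by (subst (asm) ennreal_inj) (auto intro!: mult_nonneg_nonneg integral_nonneg_AE AE_I2)
  \<comment> \<open>The 8 is 2^2 * 2 from \<open>U_moment\<close> with q = 1. Then 8 * 6 = 48, and
    1/(N - 1) \<le> 2/N doubles this to 96.\<close>
  also have "\<dots> \<le> (8 * \<sigma>\<^sup>2 / ((real N - 1) * \<sigma>\<^sup>2)) * (6 * \<sigma>\<^sup>2)"
    using U_moment[OF i, of 1] V_fluctuation(2) two_le_N normal_moment_1
    by (intro mult_mono) (auto intro!: integral_nonneg_AE AE_I2)
  also have "\<dots> = 48 * \<sigma>\<^sup>2 * (1 / (real N - 1))" using \<sigma>_pos by simp
  also have "1 / (real N - 1) \<le> 2 / real N" using two_le_N by (simp add: field_simps)
  also have "48 * \<sigma>\<^sup>2 * (2 / real N) = 96 * \<sigma>\<^sup>2 / real N" by simp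
  finally show "(\<integral>x. (U i x)\<^sup>2 * ?w (V x) \<partial>Q) \<le> 96 * \<sigma>\<^sup>2 / real N" by (simp add: mult_left_mono)
qed

lemma coord_moment:
  assumes i: "i < N"
  shows "integrable Q (\<lambda>x. (x i) ^ (2 * q))"
    "(\<integral>x. (x i) ^ (2 * q) \<partial>Q) \<le> 2 ^ (2 * q) * (m ^ (2 * q) + normal_moment \<sigma> q)"
proof -
  let ?g = "\<lambda>x. 2 ^ (2 * q) * (m ^ (2 * q) + (x i - m) ^ (2 * q))"
  have g: "integrable Q ?g" using integrable_coord_power[OF i] by simp
  have gi: "(\<integral>x. ?g x \<partial>Q) = 2 ^ (2 * q) * (m ^ (2 * q) + normal_moment \<sigma> q)"
    using integrable_coord_power[OF i] expectation_coord_even[OF i] prob_space by simp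
  have le: "(x i) ^ (2 * q) \<le> ?g x" for x
    using power_even_add_le[of m "x i - m" q] by simp
  have me: "(\<lambda>x. (x i) ^ (2 * q)) \<in> borel_measurable Q" using random_variable_coord[OF i] by measurable
  note dom = integrable_dominated[OF g me]
  show "integrable Q (\<lambda>x. (x i) ^ (2 * q))" using dom(1) le by simp
  have "(\<integral>x. (x i) ^ (2 * q) \<partial>Q) \<le> (\<integral>x. ?g x \<partial>Q)" using dom(2) le by simp
  thus "(\<integral>x. (x i) ^ (2 * q) \<partial>Q) \<le> 2 ^ (2 * q) * (m ^ (2 * q) + normal_moment \<sigma> q)" by (simp only: gi)
qed

context
  fixes \<rho> :: real
  assumes \<rho>: "\<rho> - m\<^sup>2 = \<sigma>\<^sup>2"
begin

lemma mc_proj_eq: "i < N \<Longrightarrow> mc_proj m \<rho> N x i = m + sqrt (real N) * \<sigma> * U i x"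
  using \<sigma>_pos by (simp add: mc_proj_def mc_radius_def \<rho> real_sqrt_mult)

text \<open>Scaling by sqrt N \<sigma> compensates the decay of \<open>U\<close>. What remains is a
  power of N/(N - 1) \<le> 2, whence the factor 2^q and a bound free of N.\<close>

lemma proj_moment:
  assumes i: "i < N"
  shows "integrable Q (\<lambda>x. (mc_proj m \<rho> N x i) ^ (2 * q))"
    "(\<integral>x. (mc_proj m \<rho> N x i) ^ (2 * q) \<partial>Q)
       \<le> 2 ^ (2 * q) * (m ^ (2 * q) + 2 ^ q * (2 ^ (2 * q) * (2 * normal_moment \<sigma> q)))"
proof -
  let ?c = "2 ^ (2 * q) * (2 * normal_moment \<sigma> q)"
  let ?g = "\<lambda>x. 2 ^ (2 * q) * (m ^ (2 * q) + (real N * \<sigma>\<^sup>2) ^ q * (U i x) ^ (2 * q))"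
  have g: "integrable Q ?g" using integrable_U[OF i] by simp
  have c: "?c \<ge> 0" by (simp add: normal_moment_nonneg)
  have "(real N * \<sigma>\<^sup>2) ^ q * (\<integral>x. (U i x) ^ (2 * q) \<partial>Q) \<le> (real N * \<sigma>\<^sup>2) ^ q * (?c / ((real N - 1) * \<sigma>\<^sup>2) ^ q)"
    by (intro mult_left_mono U_moment i) simp
  also have "\<dots> = (real N / (real N - 1)) ^ q * ?c"
    using \<sigma>_pos two_le_N by (simp add: power_mult_distrib power_divide)
  also have "\<dots> \<le> 2 ^ q * ?c"
    using c two_le_N by (intro mult_right_mono power_mono) (auto simp: field_simps)
  finally have u: "(real N * \<sigma>\<^sup>2) ^ q * (\<integral>x. (U i x) ^ (2 * q) \<partial>Q) \<le> 2 ^ q * ?c" .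
  have gi: "(\<integral>x. ?g x \<partial>Q) = 2 ^ (2 * q) * (m ^ (2 * q) + (real N * \<sigma>\<^sup>2) ^ q * (\<integral>x. (U i x) ^ (2 * q) \<partial>Q))"
    using integrable_U[OF i] prob_space by simp
  have le: "(mc_proj m \<rho> N x i) ^ (2 * q) \<le> ?g x" for x
  proof -
    have "(sqrt (real N) * \<sigma> * U i x) ^ (2 * q) = (real N * \<sigma>\<^sup>2) ^ q * (U i x) ^ (2 * q)"
      by (simp only: power_mult_distrib power_mult real_sqrt_pow2 of_nat_0_le_iff)
    thus ?thesis using power_even_add_le[of m "sqrt (real N) * \<sigma> * U i x" q] i
      by (simp only: mc_proj_eq)
  qed
  have me: "(\<lambda>x. (mc_proj m \<rho> N x i) ^ (2 * q)) \<in> borel_measurable Q"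
    unfolding mc_proj_eq[OF i] using i by measurable
  note dom = integrable_dominated[OF g me]
  show "integrable Q (\<lambda>x. (mc_proj m \<rho> N x i) ^ (2 * q))" using dom(1) le by simp
  have "(\<integral>x. (mc_proj m \<rho> N x i) ^ (2 * q) \<partial>Q) \<le> (\<integral>x. ?g x \<partial>Q)" using dom(2) le by simp
  also have "\<dots> \<le> 2 ^ (2 * q) * (m ^ (2 * q) + 2 ^ q * ?c)"
    unfolding gi using u by simp
  finally show "(\<integral>x. (mc_proj m \<rho> N x i) ^ (2 * q) \<partial>Q) \<le> 2 ^ (2 * q) * (m ^ (2 * q) + 2 ^ q * ?c)" .
qed

text \<open>As x_i is U_i V plus the mean, the displacement is U_i (sqrt N \<sigma> - V) - B. Both
  terms are of order N^(-1/2) in mean square, and 194 = 2 * 96 + 2.\<close>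

lemma proj_distance:
  assumes i: "i < N"
  shows "integrable Q (\<lambda>x. (mc_proj m \<rho> N x i - x i)\<^sup>2)"
    "(\<integral>x. (mc_proj m \<rho> N x i - x i)\<^sup>2 \<partial>Q) \<le> 194 * \<sigma>\<^sup>2 / real N"
proof -
  let ?g = "\<lambda>x. 2 * ((U i x)\<^sup>2 * (sqrt (real N) * \<sigma> - V x)\<^sup>2) + 2 * (B x)\<^sup>2"
  have g: "integrable Q ?g" using U_fluctuation(1)[OF i] B_square(1) by simp
  have "(\<integral>x. ?g x \<partial>Q) \<le> 2 * (96 * \<sigma>\<^sup>2 / real N) + 2 * (\<sigma>\<^sup>2 / real N)"
    using U_fluctuation[OF i] B_square by simp
  hence gi: "(\<integral>x. ?g x \<partial>Q) \<le> 194 * \<sigma>\<^sup>2 / real N" by (simp add: add_divide_distrib)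
  have le: "(mc_proj m \<rho> N x i - x i)\<^sup>2 \<le> ?g x" for x
  proof -
    have "x i = U i x * V x + vmean N x"
      using vdev_eq_U[OF i, of x] i by (simp add: vdev_def)
    hence "mc_proj m \<rho> N x i - x i = U i x * (sqrt (real N) * \<sigma> - V x) - B x"
      using mc_proj_eq[OF i, of x] by (simp only:) (simp add: algebra_simps)
    moreover have "(a - b)\<^sup>2 \<le> 2 * a\<^sup>2 + 2 * b\<^sup>2" for a b :: real
      using zero_le_power2[of "a + b"] by (simp add: power2_eq_square algebra_simps)
    ultimately show ?thesis by (metis power_mult_distrib)
  qed
  have me: "(\<lambda>x. (mc_proj m \<rho> N x i - x i)\<^sup>2) \<in> borel_measurable Q"
    unfolding mc_proj_eq[OF i] using i random_variable_coord[OF i] by measurable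
  note dom = integrable_dominated[OF g me]
  show "integrable Q (\<lambda>x. (mc_proj m \<rho> N x i - x i)\<^sup>2)" using dom(1) le by simp
  have "(\<integral>x. (mc_proj m \<rho> N x i - x i)\<^sup>2 \<partial>Q) \<le> (\<integral>x. ?g x \<partial>Q)" using dom(2) le by simp
  with gi show "(\<integral>x. (mc_proj m \<rho> N x i - x i)\<^sup>2 \<partial>Q) \<le> 194 * \<sigma>\<^sup>2 / real N" by simp
qed

end
end

section \<open>Comparison of expectations\<close>

text \<open>The parameter \<open>s\<close> balances the quadratic distance against the growth term; it will be \<open>sqrt N\<close>.\<close>
definition quadratic_modulus :: "nat set \<Rightarrow> nat \<Rightarrow> real \<Rightarrow> ((nat \<Rightarrow> real) \<Rightarrow> real) \<Rightarrow> bool" where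
  "quadratic_modulus I n K F \<longleftrightarrow> (\<forall>s>0. \<forall>a x. \<bar>F a - F x\<bar> \<le>
     K * (s * (\<Sum>i\<in>I. (a i - x i)\<^sup>2) + (1 + (\<Sum>i\<in>I. (a i) ^ (2 * n) + (x i) ^ (2 * n))) / s))"

text \<open>The bound in \<open>proj_moment\<close>, named because it is free of N and enters
  constants that must be fixed before N varies.\<close>

definition proj_bound :: "real \<Rightarrow> real \<Rightarrow> nat \<Rightarrow> real" where
  "proj_bound m \<sigma> q = 2 ^ (2 * q) * (m ^ (2 * q) + 2 ^ q * (2 ^ (2 * q) * (2 * normal_moment \<sigma> q)))"

definition coord_bound :: "real \<Rightarrow> real \<Rightarrow> nat \<Rightarrow> real" where
  "coord_bound m \<sigma> q = 2 ^ (2 * q) * (m ^ (2 * q) + normal_moment \<sigma> q)"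

context gaussian_vector
begin

context
  fixes \<rho> K :: real and I :: "nat set" and n :: nat and F :: "(nat \<Rightarrow> real) \<Rightarrow> real"
  assumes \<rho>: "\<rho> - m\<^sup>2 = \<sigma>\<^sup>2" and I: "I \<subseteq> {..<N}" and K: "K \<ge> 0"
    and F_measurable: "F \<in> borel_measurable (leb N)" and F: "quadratic_modulus I n K F"
begin

abbreviation proj where "proj \<equiv> mc_proj m \<rho> N"

lemma I_less: "i \<in> I \<Longrightarrow> i < N" using I by auto

lemma F_modulus: "s > 0 \<Longrightarrow> \<bar>F a - F x\<bar> \<le>
     K * (s * (\<Sum>i\<in>I. (a i - x i)\<^sup>2) + (1 + (\<Sum>i\<in>I. (a i) ^ (2 * n) + (x i) ^ (2 * n))) / s)"
  using F by (auto simp: quadratic_modulus_def)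

text \<open>The modulus at x = 0 with s = 1. The term \<open>0 ^ (2 * n)\<close> is 1 for n = 0,
  which explains the summand 1 next to \<open>proj_bound m \<sigma> n\<close> in
  \<open>F_proj_bounded\<close>.\<close>

lemma F_growth: "\<bar>F a\<bar> \<le> \<bar>F (\<lambda>_. 0)\<bar> + K * ((\<Sum>i\<in>I. (a i)\<^sup>2) + (1 + (\<Sum>i\<in>I. (a i) ^ (2 * n) + 0 ^ (2 * n))))"
  using F_modulus[of 1 a "\<lambda>_. 0"] by (simp add: abs_le_iff) linarith

lemma F_measurable_Q: "F \<in> borel_measurable Q"
  using F_measurable by measurable

lemma F_proj_measurable: "(\<lambda>x. F (proj x)) \<in> borel_measurable Q"
  using F_measurable by measurable

text \<open>The crude bound serves the mixture of the two roots: there the small weight multiplies a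
  difference of expectations that must stay bounded in N.\<close>

lemma F_proj_bounded:
  "integrable Q (\<lambda>x. F (proj x))"
  "\<bar>\<integral>x. F (proj x) \<partial>Q\<bar> \<le> \<bar>F (\<lambda>_. 0)\<bar> + K * (real (card I) * proj_bound m \<sigma> 1 + (1 + real (card I) * (proj_bound m \<sigma> n + 1)))"
proof -
  let ?g = "\<lambda>x. \<bar>F (\<lambda>_. 0)\<bar> + K * ((\<Sum>i\<in>I. (proj x i) ^ (2 * 1)) + (1 + (\<Sum>i\<in>I. (proj x i) ^ (2 * n) + 0 ^ (2 * n))))"
  note pm = proj_moment[OF \<rho> I_less, folded proj_bound_def]
  have g: "integrable Q ?g"
    by (intro Bochner_Integration.integrable_add integrable_mult_right Bochner_Integration.integrable_sum pm(1) integrable_const)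
  have "(\<integral>x. ?g x \<partial>Q) = \<bar>F (\<lambda>_. 0)\<bar> + K * ((\<Sum>i\<in>I. \<integral>x. (proj x i) ^ (2 * 1) \<partial>Q) + 
      (1 + (\<Sum>i\<in>I. (\<integral>x. (proj x i) ^ (2 * n) \<partial>Q) + 0 ^ (2 * n))))"
    using pm(1)[of _ 1] pm(1)[of _ n] by (simp add: Bochner_Integration.integral_sum)
  also have "\<dots> \<le> \<bar>F (\<lambda>_. 0)\<bar> + K * ((\<Sum>i\<in>I. proj_bound m \<sigma> 1) + (1 + (\<Sum>i\<in>I. proj_bound m \<sigma> n + 1)))"
    by (intro add_left_mono mult_left_mono K add_mono sum_mono pm(2) order_refl) (auto intro: power_le_one)
  finally have gi: "(\<integral>x. ?g x \<partial>Q) \<le> \<bar>F (\<lambda>_. 0)\<bar> + K * (real (card I) * proj_bound m \<sigma> 1 + (1 + real (card I) * (proj_bound m \<sigma> n + 1)))"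
    by simp
  have le: "\<bar>F (proj x)\<bar> \<le> ?g x" for x using F_growth[of "proj x"] by simp
  note d = integrable_dominated[OF g borel_measurable_abs[OF F_proj_measurable] abs_ge_zero le]
  show i: "integrable Q (\<lambda>x. F (proj x))"
    using integrable_abs_cancel[OF d(1) F_proj_measurable] .
  have "\<bar>\<integral>x. F (proj x) \<partial>Q\<bar> \<le> (\<integral>x. \<bar>F (proj x)\<bar> \<partial>Q)" by (rule integral_abs_bound)
  also note d(2) also note gi
  finally show "\<bar>\<integral>x. F (proj x) \<partial>Q\<bar> \<le> \<bar>F (\<lambda>_. 0)\<bar> + K * (real (card I) * proj_bound m \<sigma> 1 + (1 + real (card I) * (proj_bound m \<sigma> n + 1)))" .
qed

lemma F_integrable: "integrable Q F"
proof -
  let ?g = "\<lambda>x. \<bar>F (\<lambda>_. 0)\<bar> + K * ((\<Sum>i\<in>I. (x i) ^ (2 * 1)) + (1 + (\<Sum>i\<in>I. (x i) ^ (2 * n) + 0 ^ (2 * n))))"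
  have g: "integrable Q ?g"
    by (intro Bochner_Integration.integrable_add integrable_mult_right Bochner_Integration.integrable_sum coord_moment(1) integrable_const I_less)
  have le: "\<bar>F x\<bar> \<le> ?g x" for x using F_growth[of x] by simp
  note d = integrable_dominated[OF g borel_measurable_abs[OF F_measurable_Q] abs_ge_zero le]
  show ?thesis using integrable_abs_cancel[OF d(1) F_measurable_Q] .
qed

text \<open>At s = sqrt N the modulus pairs s with a mean square distance O(1/N) and 1/s with
  bounded moments, so both contributions have the same order.\<close>

lemma F_proj_close:
  "\<bar>(\<integral>x. F (proj x) \<partial>Q) - (\<integral>x. F x \<partial>Q)\<bar> \<le>
     K * (real (card I) * (194 * \<sigma>\<^sup>2) + (1 + real (card I) * (proj_bound m \<sigma> n + coord_bound m \<sigma> n))) / sqrt (real N)"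
proof -
  define s where "s = sqrt (real N)"
  have s: "s > 0" "s\<^sup>2 = real N" using N_pos by (auto simp: s_def)
  let ?g = "\<lambda>x. K * (s * (\<Sum>i\<in>I. (proj x i - x i)\<^sup>2) + (1 + (\<Sum>i\<in>I. (proj x i) ^ (2 * n) + (x i) ^ (2 * n))) / s)"
  note pm = proj_moment[OF \<rho> I_less, folded proj_bound_def] and pd = proj_distance[OF \<rho> I_less]
    and cm = coord_moment[OF I_less, folded coord_bound_def]
  have g: "integrable Q ?g"
    by (intro Bochner_Integration.integrable_add integrable_mult_right Bochner_Integration.integrable_sum
        Bochner_Integration.integrable_divide pm(1) pd(1) cm(1) integrable_const)
  have "(\<integral>x. ?g x \<partial>Q) = K * (s * (\<Sum>i\<in>I. \<integral>x. (proj x i - x i)\<^sup>2 \<partial>Q) +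
      (1 + (\<Sum>i\<in>I. (\<integral>x. (proj x i) ^ (2 * n) \<partial>Q) + (\<integral>x. (x i) ^ (2 * n) \<partial>Q))) / s)"
    using pd(1) pm(1)[of _ n] cm(1)[of _ n] by (simp add: Bochner_Integration.integral_sum)
  also have "\<dots> \<le> K * (s * (\<Sum>i\<in>I. 194 * \<sigma>\<^sup>2 / real N) + (1 + (\<Sum>i\<in>I. proj_bound m \<sigma> n + coord_bound m \<sigma> n)) / s)"
    using s by (intro mult_left_mono K add_mono sum_mono divide_right_mono pm(2) pd(2) cm(2) order_refl) auto
  also have "\<dots> = K * (real (card I) * (194 * \<sigma>\<^sup>2) + (1 + real (card I) * (proj_bound m \<sigma> n + coord_bound m \<sigma> n))) / s"
    using s(1) unfolding s(2)[symmetric] by (simp add: field_simps power2_eq_square)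
  finally have gi: "(\<integral>x. ?g x \<partial>Q) \<le> K * (real (card I) * (194 * \<sigma>\<^sup>2) + (1 + real (card I) * (proj_bound m \<sigma> n + coord_bound m \<sigma> n))) / s" .
  have le: "\<bar>F (proj x) - F x\<bar> \<le> ?g x" for x by (rule F_modulus[OF s(1)])
  have "(\<integral>x. F (proj x) \<partial>Q) - (\<integral>x. F x \<partial>Q) = (\<integral>x. F (proj x) - F x \<partial>Q)"
    using F_proj_bounded(1) F_integrable by simp
  also have "\<bar>\<dots>\<bar> \<le> (\<integral>x. \<bar>F (proj x) - F x\<bar> \<partial>Q)" by (rule integral_abs_bound)
  also have "\<dots> \<le> (\<integral>x. ?g x \<partial>Q)"
    using F_proj_measurable F_measurable_Q by (intro integrable_dominated(2)[OF g] le) auto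
  also note gi
  finally show ?thesis by (simp only: s_def)
qed

end
end

lemma gaussian_vector_mc:
  "m\<^sup>2 < \<rho> \<Longrightarrow> 2 \<le> N \<Longrightarrow> gaussian_vector (sqrt (\<rho> - m\<^sup>2)) N"
  by unfold_locales auto

lemma mc_expect_bounded:
  assumes m: "m\<^sup>2 < \<rho>" and K: "K \<ge> 0" and F: "quadratic_modulus I n K F"
  obtains C where "\<And>N. 2 \<le> N \<Longrightarrow> I \<subseteq> {..<N} \<Longrightarrow> F \<in> borel_measurable (leb N) \<Longrightarrow> \<bar>mc_expect m \<rho> N F\<bar> \<le> C"
proof
  let ?\<sigma> = "sqrt (\<rho> - m\<^sup>2)"
  fix N :: nat assume N: "2 \<le> N" "I \<subseteq> {..<N}" "F \<in> borel_measurable (leb N)"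
  interpret gaussian_vector m ?\<sigma> N using gaussian_vector_mc[OF m N(1)] .
  have \<rho>: "\<rho> - m\<^sup>2 = ?\<sigma>\<^sup>2" using m by simp
  show "\<bar>mc_expect m \<rho> N F\<bar> \<le> \<bar>F (\<lambda>_. 0)\<bar> + K * (real (card I) * proj_bound m ?\<sigma> 1
       + (1 + real (card I) * (proj_bound m ?\<sigma> n + 1)))"
    using F_proj_bounded(2)[OF \<rho> N(2) K N(3) F] unfolding mc_expect_eq_gauss[OF m N(3)] .
qed

lemma mc_gc_close:
  assumes m: "m\<^sup>2 < \<rho>" and K: "K \<ge> 0" and F: "quadratic_modulus I n K F"
  obtains C where "\<And>N. 2 \<le> N \<Longrightarrow> I \<subseteq> {..<N} \<Longrightarrow> F \<in> borel_measurable (leb N) \<Longrightarrow>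
    \<bar>mc_expect m \<rho> N F - gc_expect (- m / (\<rho> - m\<^sup>2)) (1 / (2 * (\<rho> - m\<^sup>2))) N F\<bar> \<le> C / sqrt (real N)"
proof
  let ?\<sigma> = "sqrt (\<rho> - m\<^sup>2)"
  fix N :: nat assume N: "2 \<le> N" "I \<subseteq> {..<N}" "F \<in> borel_measurable (leb N)"
  interpret gaussian_vector m ?\<sigma> N using gaussian_vector_mc[OF m N(1)] .
  have \<rho>: "\<rho> - m\<^sup>2 = ?\<sigma>\<^sup>2" using m by simp
  have gc: "gc_expect (- m / (\<rho> - m\<^sup>2)) (1 / (2 * (\<rho> - m\<^sup>2))) N F = (\<integral>x. F x \<partial>Q)"
    by (rule gc_expect_eq_gauss[OF N(3)]) (simp_all only: \<rho>[symmetric])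
  show "\<bar>mc_expect m \<rho> N F - gc_expect (- m / (\<rho> - m\<^sup>2)) (1 / (2 * (\<rho> - m\<^sup>2))) N F\<bar> \<le> 
     (K * (real (card I) * (194 * ?\<sigma>\<^sup>2) + (1 + real (card I) * (proj_bound m ?\<sigma> n + coord_bound m ?\<sigma> n)))) / sqrt (real N)"
    using F_proj_close[OF \<rho> N(2) K N(3) F] unfolding mc_expect_eq_gauss[OF m N(3)] gc .
qed

section \<open>Moduli of continuity and measurability of the observables\<close>

lemma mult_le_quadratic:
  fixes a b s :: real
  assumes "s > 0" shows "a * b \<le> s * a\<^sup>2 + b\<^sup>2 / s"
proof -
  have "(s * a\<^sup>2 + b\<^sup>2 / s) - a * b = ((s * a - b / 2)\<^sup>2 + 3 / 4 * b\<^sup>2) / s"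
    using assms by (simp add: field_simps power2_eq_square)
  also have "\<dots> \<ge> 0" using assms by simp
  finally show ?thesis by simp
qed

text \<open>Young's inequality with b = 1 covers the Lipschitz bound; the growth sum is nonnegative
  and may be added for any n.\<close>

lemma quadratic_modulus_lipschitz:
  assumes "\<And>a x. \<bar>F a - F x\<bar> \<le> sqrt (\<Sum>i\<in>I. (a i - x i)\<^sup>2)"
  shows "quadratic_modulus I n 1 F"
  unfolding quadratic_modulus_def
proof (intro allI impI)
  fix s :: real and a x :: "nat \<Rightarrow> real" assume s: "s > 0"
  let ?S = "\<Sum>i\<in>I. (a i - x i)\<^sup>2"
  have "\<bar>F a - F x\<bar> \<le> sqrt ?S" by (rule assms)
  also have "\<dots> \<le> s * ?S + 1 / s" using mult_le_quadratic[OF s, of "sqrt ?S" 1] by (simp add: sum_nonneg)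
  also have "\<dots> \<le> 1 * (s * ?S + (1 + (\<Sum>i\<in>I. (a i) ^ (2 * n) + (x i) ^ (2 * n))) / s)"
    using s by (simp add: divide_right_mono sum_nonneg)
  finally show "\<bar>F a - F x\<bar> \<le> 1 * (s * ?S + (1 + (\<Sum>i\<in>I. (a i) ^ (2 * n) + (x i) ^ (2 * n))) / s)" .
qed

text \<open>Division by R, the maximum of 1 and all |a_i| and |x_i|, moves the entries to [-1, 1],
  where differences of products and powers are bounded by sums of coordinate differences. Young's
  inequality absorbs the factor R^n, as R^(2n) is at most the growth term.\<close>

lemma quadratic_modulus_monomial:
  fixes d :: "nat \<Rightarrow> nat"
  assumes I: "finite I"
  defines "n \<equiv> \<Sum>i\<in>I. d i"
  shows "quadratic_modulus I n (real n * (real (card I) + 1)) (\<lambda>a. \<Prod>i\<in>I. (a i) ^ d i)"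
  unfolding quadratic_modulus_def
proof (intro allI impI)
  fix s :: real and a x :: "nat \<Rightarrow> real" assume s: "s > 0"
  \<comment> \<open>Inserting 1 gives R \<ge> 1 and keeps the set nonempty when \<open>I\<close> is
    empty.\<close>
  define R where "R = Max (insert 1 ((\<lambda>i. \<bar>a i\<bar>) ` I \<union> (\<lambda>i. \<bar>x i\<bar>) ` I))"
  let ?T = "1 + (\<Sum>i\<in>I. (a i) ^ (2 * n) + (x i) ^ (2 * n))"
  let ?S = "\<Sum>i\<in>I. (a i - x i)\<^sup>2"
  have fin: "finite (insert 1 ((\<lambda>i. \<bar>a i\<bar>) ` I \<union> (\<lambda>i. \<bar>x i\<bar>) ` I))" using I by auto
  have R1: "R \<ge> 1" and Ra: "\<And>i. i \<in> I \<Longrightarrow> \<bar>a i\<bar> \<le> R" and Rx: "\<And>i. i \<in> I \<Longrightarrow> \<bar>x i\<bar> \<le> R"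
    unfolding R_def using fin by (auto intro!: Max_ge)
  have "R \<in> insert 1 ((\<lambda>i. \<bar>a i\<bar>) ` I \<union> (\<lambda>i. \<bar>x i\<bar>) ` I)"
    unfolding R_def using fin by (intro Max_in) auto
  then consider "R = 1" | i where "i \<in> I" "R = \<bar>a i\<bar> \<or> R = \<bar>x i\<bar>" by auto
  hence RT: "(R ^ n)\<^sup>2 \<le> ?T"
  proof cases
    case 1 thus ?thesis by (simp add: sum_nonneg)
  next
    case 2
    have "(R ^ n)\<^sup>2 = R ^ (2 * n)" by (simp add: power_mult[symmetric] mult.commute)
    also have "\<dots> \<le> (a i) ^ (2 * n) + (x i) ^ (2 * n)" using 2(2) by (auto simp: power_even_abs)
    also have "\<dots> \<le> (\<Sum>i\<in>I. (a i) ^ (2 * n) + (x i) ^ (2 * n))"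
      using member_le_sum[of i I "\<lambda>i. (a i) ^ (2 * n) + (x i) ^ (2 * n)"] 2(1) I by auto
    finally show ?thesis by simp
  qed
  have scale: "(\<Prod>i\<in>I. (y i) ^ d i) = R ^ n * (\<Prod>i\<in>I. (y i / R) ^ d i)" for y
  proof -
    have "(\<Prod>i\<in>I. (y i) ^ d i) = (\<Prod>i\<in>I. R ^ d i * (y i / R) ^ d i)"
      using R1 by (intro prod.cong refl) (simp add: power_divide)
    thus ?thesis by (simp add: prod.distrib n_def power_sum)
  qed
  have "\<bar>(\<Prod>i\<in>I. (a i / R) ^ d i) - (\<Prod>i\<in>I. (x i / R) ^ d i)\<bar> \<le> (\<Sum>i\<in>I. \<bar>(a i / R) ^ d i - (x i / R) ^ d i\<bar>)"
    using R1 Ra Rx norm_prod_diff[of I "\<lambda>i. (a i / R) ^ d i" "\<lambda>i. (x i / R) ^ d i"]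
    by (simp add: power_abs power_le_one)
  also have "\<dots> \<le> (\<Sum>i\<in>I. real n * \<bar>a i - x i\<bar>)"
  proof (rule sum_mono)
    fix i assume i: "i \<in> I"
    have "\<bar>(a i / R) ^ d i - (x i / R) ^ d i\<bar> \<le> real (d i) * \<bar>a i / R - x i / R\<bar>"
      using R1 Ra[OF i] Rx[OF i] norm_power_diff[of "a i / R" "x i / R" "d i"] by simp
    also have "\<dots> = real (d i) * (\<bar>a i - x i\<bar> / R)"
      using R1 by (simp add: diff_divide_distrib[symmetric])
    also have "\<dots> \<le> real n * \<bar>a i - x i\<bar>"
    proof (rule mult_mono)
      have "d i \<le> n" using member_le_sum[of i I d] i I by (simp add: n_def)
      thus "real (d i) \<le> real n" by (simp only: of_nat_le_iff)
      have "\<bar>a i - x i\<bar> * 1 \<le> \<bar>a i - x i\<bar> * R" using R1 by (intro mult_left_mono) auto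
      thus "\<bar>a i - x i\<bar> / R \<le> \<bar>a i - x i\<bar>" using R1 by (simp add: divide_le_eq)
    qed (use R1 in auto)
    finally show "\<bar>(a i / R) ^ d i - (x i / R) ^ d i\<bar> \<le> real n * \<bar>a i - x i\<bar>" .
  qed
  finally have diff: "\<bar>(\<Prod>i\<in>I. (a i / R) ^ d i) - (\<Prod>i\<in>I. (x i / R) ^ d i)\<bar> \<le> (\<Sum>i\<in>I. real n * \<bar>a i - x i\<bar>)" .
  have "\<bar>(\<Prod>i\<in>I. (a i) ^ d i) - (\<Prod>i\<in>I. (x i) ^ d i)\<bar> = R ^ n * \<bar>(\<Prod>i\<in>I. (a i / R) ^ d i) - (\<Prod>i\<in>I. (x i / R) ^ d i)\<bar>"
    unfolding scale[of a] scale[of x] using R1 by (simp add: right_diff_distrib[symmetric] abs_mult)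
  also have "\<dots> \<le> R ^ n * (\<Sum>i\<in>I. real n * \<bar>a i - x i\<bar>)"
    using R1 diff by (intro mult_left_mono) auto
  also have "\<dots> = real n * (\<Sum>i\<in>I. \<bar>a i - x i\<bar> * R ^ n)"
    by (simp add: sum_distrib_left sum_distrib_right mult_ac)
  also have "\<dots> \<le> real n * (\<Sum>i\<in>I. s * (a i - x i)\<^sup>2 + ?T / s)"
  proof (intro mult_left_mono sum_mono)
    fix i
    have "\<bar>a i - x i\<bar> * R ^ n \<le> s * \<bar>a i - x i\<bar>\<^sup>2 + (R ^ n)\<^sup>2 / s" by (rule mult_le_quadratic[OF s])
    also have "\<dots> \<le> s * (a i - x i)\<^sup>2 + ?T / s" using RT s by (simp add: divide_right_mono)
    finally show "\<bar>a i - x i\<bar> * R ^ n \<le> s * (a i - x i)\<^sup>2 + ?T / s" .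
  qed simp
  also have "\<dots> = real n * (s * ?S + real (card I) * (?T / s))"
    by (simp add: sum.distrib sum_distrib_left)
  also have "\<dots> \<le> real n * ((real (card I) + 1) * (s * ?S + ?T / s))"
  proof (rule mult_left_mono)
    have "0 \<le> real (card I) * (s * ?S)" "0 \<le> ?T / s" using s by (auto intro!: mult_nonneg_nonneg add_nonneg_nonneg sum_nonneg divide_nonneg_pos)
    thus "s * ?S + real (card I) * (?T / s) \<le> (real (card I) + 1) * (s * ?S + ?T / s)"
      by (simp only: distrib_left distrib_right mult_1_left)
  qed simp
  finally show "\<bar>(\<Prod>i\<in>I. (a i) ^ d i) - (\<Prod>i\<in>I. (x i) ^ d i)\<bar> \<le> real n * (real (card I) + 1) * (s * ?S + ?T / s)"
    by (simp only: mult.assoc)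
qed

text \<open>The bound makes \<open>F\<close> continuous for the product topology on all of
  \<open>nat \<Rightarrow> real\<close>, and the identity from \<open>leb N\<close> into that space
  is measurable coordinate by coordinate.\<close>

lemma measurable_lipschitz_coords:
  assumes I: "finite I" and lip: "\<And>a x. \<bar>F a - F x\<bar> \<le> sqrt (\<Sum>i\<in>I. (a i - x i)\<^sup>2)"
  shows "F \<in> borel_measurable (leb N)"
proof -
  have "isCont F x" for x :: "nat \<Rightarrow> real"
  proof -
    have "continuous_on UNIV (\<lambda>a :: nat \<Rightarrow> real. a i)" for i
      by (rule continuous_on_product_coordinates)
    hence "(\<lambda>a. a i) \<midarrow>x\<rightarrow> x i" for i
      by (simp add: continuous_on_def)
    hence "((\<lambda>a. sqrt (\<Sum>i\<in>I. (a i - x i)\<^sup>2)) \<longlongrightarrow> sqrt (\<Sum>i\<in>I. (x i - x i)\<^sup>2)) (at x)"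
      by (intro tendsto_intros)
    hence "((\<lambda>a. sqrt (\<Sum>i\<in>I. (a i - x i)\<^sup>2)) \<longlongrightarrow> 0) (at x)" by simp
    hence "((\<lambda>a. F a - F x) \<longlongrightarrow> 0) (at x)"
      by (rule Lim_null_comparison[rotated]) (simp add: lip)
    thus ?thesis by (simp add: isCont_def LIM_zero_iff)
  qed
  hence F: "F \<in> borel_measurable borel"
    by (intro borel_measurable_continuous_onI) (simp add: continuous_at_imp_continuous_on)
  have "(\<lambda>x. x i) \<in> borel_measurable (leb N)" for i
  proof (cases "i < N")
    case True thus ?thesis by (rule measurable_coord)
  next
    \<comment> \<open>Points of \<open>leb N\<close> are extensional, so a coordinate outside {..<N}
      takes the constant value \<open>undefined\<close>.\<close>
    case False
    have "(\<lambda>x. x i) \<in> borel_measurable (leb N) \<longleftrightarrow> (\<lambda>_. undefined :: real) \<in> borel_measurable (leb N)"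
      using False by (intro measurable_cong) (auto simp: space_PiM PiE_def extensional_def)
    thus ?thesis by simp
  qed
  hence "(\<lambda>x. x) \<in> leb N \<rightarrow>\<^sub>M borel"
    by (rule measurable_coordinatewise_then_product)
  from measurable_compose[OF this F] show ?thesis by simp
qed

section \<open>Weights in the fixed energy ensemble\<close>

lemma mixture_close:
  fixes z z' e e' C :: real
  assumes "z > 0" "z' > 0" "\<bar>e\<bar> \<le> C" "\<bar>e'\<bar> \<le> C'"
  shows "\<bar>(z * e + z' * e') / (z + z') - e\<bar> \<le> (C + C') * (z' / z)"
proof -
  have "(z * e + z' * e') / (z + z') - e = (e' - e) * (z' / (z + z'))"
    using assms by (simp add: field_simps)
  also have "\<bar>\<dots>\<bar> = \<bar>e' - e\<bar> * (z' / (z + z'))"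
    using assms by (simp add: abs_mult)
  also have "\<dots> \<le> (C + C') * (z' / z)"
    using assms by (intro mult_mono frac_le) auto
  finally show ?thesis .
qed

text \<open>Both normalizations carry the exponent (N - 3)/2, and \<rho> - m'^2 < \<rho> - m^2, so
  the quotient is geometric in N with ratio exp(-c/2) < 1.\<close>

lemma mc_Z_ratio_bigo:
  assumes "m\<^sup>2 < m'\<^sup>2" "m'\<^sup>2 < \<rho>"
  shows "(\<lambda>N. mc_Z m' \<rho> N / mc_Z m \<rho> N) \<in> O(\<lambda>N. 1 / sqrt (real N))"
proof -
  define c where "c = ln (\<rho> - m\<^sup>2) - ln (\<rho> - m'\<^sup>2)"
  have c: "c > 0" using assms by (simp add: c_def)
  have "mc_Z m' \<rho> N / mc_Z m \<rho> N = exp (- c * ((real N - 3) / 2))" for N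
    using assms by (simp add: mc_Z_def powr_def c_def exp_diff[symmetric] algebra_simps diff_divide_distrib)
  moreover have "(\<lambda>N. exp (- c * ((real N - 3) / 2))) \<in> O(\<lambda>N. 1 / sqrt (real N))"
    using c by real_asymp
  ultimately show ?thesis by simp
qed

theorem theorem4p29:
  fixes J h \<rho> \<epsilon> :: real and I :: "nat set" and f :: "(nat \<Rightarrow> real) \<Rightarrow> real"
  assumes "J > 0" and "h \<noteq> 0" and "\<rho> > 0" and "\<epsilon> \<in> energy_set J h \<rho>"
    and "finite I"
    and "((\<exists>B. \<forall>x\<in>I \<rightarrow>\<^sub>E UNIV. \<bar>f x\<bar> \<le> B) \<and>
          (\<forall>x\<in>I \<rightarrow>\<^sub>E UNIV. \<forall>y\<in>I \<rightarrow>\<^sub>E UNIV. \<bar>f x - f y\<bar> \<le> sqrt (\<Sum>i\<in>I. (x i - y i)^2)))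
       \<or> (\<exists>n :: nat \<Rightarrow> nat. \<forall>x\<in>I \<rightarrow>\<^sub>E UNIV. f x = (\<Prod>i\<in>I. (x i) ^ n i))"
  shows "let m = - h / J + sgn h * sqrt (h^2 / J^2 - 2 * \<epsilon> / J);
             \<mu> = - m / (\<rho> - m^2);
             \<eta> = 1 / (2 * (\<rho> - m^2))
         in (\<lambda>N. mc_energy J h \<epsilon> \<rho> N (\<lambda>\<phi>. f (restrict \<phi> I))
                 - gc_expect \<mu> \<eta> N (\<lambda>\<phi>. f (restrict \<phi> I)))
            \<in> O(\<lambda>N. 1 / sqrt (real N))"
proof -
  \<comment> \<open>The restriction turns assumptions on extensional arguments into bounds valid for
    all functions.\<close>
  define F where "F = (\<lambda>\<phi>. f (restrict \<phi> I))"
  define s where "s = sqrt (h^2 / J^2 - 2 * \<epsilon> / J)"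
  \<comment> \<open>With the sign of h, |m| = | |h|/J - s | and |m'| = |h|/J + s: m is the root of
    smaller absolute value and m' the other one, whichever of them is \<open>m_plus\<close>.\<close>
  define m where "m = - h / J + sgn h * s"
  define m' where "m' = - h / J - sgn h * s"
  \<comment> \<open>The two classes of f merge here: from now on only the modulus and measurability
    are used.\<close>
  have "\<exists>n K. K \<ge> 0 \<and> quadratic_modulus I n K F \<and> (\<forall>N. I \<subseteq> {..<N} \<longrightarrow> F \<in> borel_measurable (leb N))"
    using assms(6)
  proof (elim disjE conjE exE)
    assume lip: "\<forall>x\<in>I \<rightarrow>\<^sub>E UNIV. \<forall>y\<in>I \<rightarrow>\<^sub>E UNIV. \<bar>f x - f y\<bar> \<le> sqrt (\<Sum>i\<in>I. (x i - y i)^2)"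
    have F: "\<bar>F a - F x\<bar> \<le> sqrt (\<Sum>i\<in>I. (a i - x i)\<^sup>2)" for a x
      using lip[rule_format, of "restrict a I" "restrict x I"] by (simp add: F_def)
    show ?thesis
      using quadratic_modulus_lipschitz[of F I, OF F] measurable_lipschitz_coords[of I F, OF assms(5) F]
      by (intro exI[of _ 0] exI[of _ 1]) auto
  next
    fix d :: "nat \<Rightarrow> nat"
    assume "\<forall>x\<in>I \<rightarrow>\<^sub>E UNIV. f x = (\<Prod>i\<in>I. (x i) ^ d i)"
    hence F: "F = (\<lambda>a. \<Prod>i\<in>I. (a i) ^ d i)" by (auto simp: F_def)
    have "F \<in> borel_measurable (leb N)" if "I \<subseteq> {..<N}" for N
      unfolding F using that by (intro borel_measurable_prod borel_measurable_power measurable_coord) auto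
    thus ?thesis using quadratic_modulus_monomial[OF assms(5), of d] unfolding F
      by (intro exI[of _ "\<Sum>i\<in>I. d i"] exI[of _ "real (\<Sum>i\<in>I. d i) * (real (card I) + 1)"])
        (auto intro!: mult_nonneg_nonneg sum_nonneg)
  qed
  then obtain n K where K: "K \<ge> 0" and F: "quadratic_modulus I n K F"
    and meas: "\<And>N. I \<subseteq> {..<N} \<Longrightarrow> F \<in> borel_measurable (leb N)" by blast
  have eps: "\<epsilon> \<le> h\<^sup>2 / (2 * J)" and eps': "\<bar>\<bar>h\<bar> / J - s\<bar> < sqrt \<rho>"
    using assms(4) by (auto simp: energy_set_def s_def)
  \<comment> \<open>The factored form shows that s = 0 exactly at the top energy h^2 / (2
    J).\<close>
  have s_arg: "h\<^sup>2 / J\<^sup>2 - 2 * \<epsilon> / J = 2 / J * (h\<^sup>2 / (2 * J) - \<epsilon>)"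
    using assms(1) by (simp add: field_simps power2_eq_square)
  have s0: "s \<ge> 0" using eps assms(1) by (simp add: s_def s_arg)
  have s_pos: "s > 0 \<longleftrightarrow> \<epsilon> < h\<^sup>2 / (2 * J)"
  proof -
    have "s > 0 \<longleftrightarrow> 0 < 2 / J * (h\<^sup>2 / (2 * J) - \<epsilon>)"
      by (simp only: s_def s_arg real_sqrt_gt_0_iff)
    also have "\<dots> \<longleftrightarrow> 0 < h\<^sup>2 / (2 * J) - \<epsilon>"
      using assms(1) by (subst zero_less_mult_iff) auto
    finally show ?thesis by simp
  qed
  have m_sgn: "m = - sgn h * (\<bar>h\<bar> / J - s)" "m' = - sgn h * (\<bar>h\<bar> / J + s)"
    using assms(2) by (auto simp: m_def m'_def sgn_if abs_if)
  have "\<bar>h\<bar> / J \<ge> 0" using assms(1) by simp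
  hence abs_m: "\<bar>m\<bar> = \<bar>\<bar>h\<bar> / J - s\<bar>" and abs_m': "\<bar>m'\<bar> = \<bar>h\<bar> / J + s"
    using assms(2) s0 unfolding m_sgn abs_mult by (simp_all add: abs_sgn_eq)
  have m\<rho>: "m\<^sup>2 < \<rho>"
  proof -
    have "\<bar>m\<bar>\<^sup>2 < (sqrt \<rho>)\<^sup>2" using eps' abs_m by (intro power_strict_mono) auto
    thus ?thesis using assms(3) by simp
  qed
  \<comment> \<open>Strict because h \<noteq> 0; for h = 0 the roots would be opposite numbers with
    equal weights.\<close>
  have abs_less: "\<bar>m\<bar> < \<bar>m'\<bar>" if "s > 0"
  proof -
    have "\<bar>h\<bar> / J > 0" using assms(1,2) by simp
    thus ?thesis using that unfolding abs_m abs_m' by linarith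
  qed
  have mm': "m\<^sup>2 < m'\<^sup>2" if "s > 0"
    using power_strict_mono[OF abs_less[OF that], of 2] by simp
  have pm: "m_plus J h \<epsilon> = (if h > 0 then m else m')" "m_minus J h \<epsilon> = (if h > 0 then m' else m)"
    using assms(2) by (auto simp: m_plus_def m_minus_def m_def m'_def s_def sgn_if)
  \<comment> \<open>From \<open>N0\<close> on the lattice contains \<open>I\<close> and has at least
    two sites.\<close>
  obtain N0 where N0: "2 \<le> N0" "I \<subseteq> {..<N0}"
  proof -
    obtain k where "I \<subseteq> {..<k}" using assms(5) finite_nat_iff_bounded by blast
    thus thesis by (intro that[of "max 2 k"]) auto
  qed
  have large: "2 \<le> N" "I \<subseteq> {..<N}" if "N \<ge> N0" for N using N0 that by auto
  have close: "(\<lambda>N. mc_expect m \<rho> N F - gc_expect (- m / (\<rho> - m\<^sup>2)) (1 / (2 * (\<rho> - m\<^sup>2))) N F) \<in> O(\<lambda>N. 1 / sqrt (real N))"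
  proof -
    obtain C where C: "\<And>N. 2 \<le> N \<Longrightarrow> I \<subseteq> {..<N} \<Longrightarrow> F \<in> borel_measurable (leb N) \<Longrightarrow>
      \<bar>mc_expect m \<rho> N F - gc_expect (- m / (\<rho> - m\<^sup>2)) (1 / (2 * (\<rho> - m\<^sup>2))) N F\<bar> \<le> C / sqrt (real N)"
      by (rule mc_gc_close[OF m\<rho> K F]) blast
    show ?thesis
    proof (rule bigoI)
      show "\<forall>\<^sub>F N in sequentially. norm (mc_expect m \<rho> N F - gc_expect (- m / (\<rho> - m\<^sup>2)) (1 / (2 * (\<rho> - m\<^sup>2))) N F)
          \<le> C * norm (1 / sqrt (real N))"
        using eventually_ge_at_top[of N0]
      proof eventually_elim
        case (elim N)
        show ?case using C[OF large[OF elim] meas[OF large(2)[OF elim]]] by simp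
      qed
    qed
  qed
  have energy: "(\<lambda>N. mc_energy J h \<epsilon> \<rho> N F - mc_expect m \<rho> N F) \<in> O(\<lambda>N. 1 / sqrt (real N))"
  proof -
    \<comment> \<open>The cases are the three branches of \<open>mc_energy\<close>; together with
      m^2 < \<rho> they exclude the branch \<open>undefined\<close>.\<close>
    consider "s > 0" "m'\<^sup>2 < \<rho>" | "s > 0" "\<rho> \<le> m'\<^sup>2" | "s = 0"
      using s0 by (metis less_eq_real_def not_le)
    thus ?thesis
    proof cases
      case 1
      obtain C where C: "\<And>N. 2 \<le> N \<Longrightarrow> I \<subseteq> {..<N} \<Longrightarrow> F \<in> borel_measurable (leb N) \<Longrightarrow> \<bar>mc_expect m \<rho> N F\<bar> \<le> C"
        by (rule mc_expect_bounded[OF m\<rho> K F]) blast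
      obtain C' where C': "\<And>N. 2 \<le> N \<Longrightarrow> I \<subseteq> {..<N} \<Longrightarrow> F \<in> borel_measurable (leb N) \<Longrightarrow> \<bar>mc_expect m' \<rho> N F\<bar> \<le> C'"
        by (rule mc_expect_bounded[OF 1(2) K F]) blast
      have e: "mc_energy J h \<epsilon> \<rho> N F = (mc_Z m \<rho> N * mc_expect m \<rho> N F + mc_Z m' \<rho> N * mc_expect m' \<rho> N F)
         / (mc_Z m \<rho> N + mc_Z m' \<rho> N)" for N
        using 1 m\<rho> s_pos by (cases "h > 0") (simp_all add: mc_energy_def Let_def pm add.commute)
      have "mc_Z m \<rho> N > 0" "mc_Z m' \<rho> N > 0" for N using 1 m\<rho> by (simp_all add: mc_Z_def)
      hence "\<bar>mc_energy J h \<epsilon> \<rho> N F - mc_expect m \<rho> N F\<bar> \<le> (C + C') * (mc_Z m' \<rho> N / mc_Z m \<rho> N)" if "N \<ge> N0" for N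
        unfolding e by (intro mixture_close C C' large meas that)
      hence bound: "\<bar>mc_energy J h \<epsilon> \<rho> N F - mc_expect m \<rho> N F\<bar> \<le> (C + C') * \<bar>mc_Z m' \<rho> N / mc_Z m \<rho> N\<bar>" if "N \<ge> N0" for N
        using that by (simp add: mc_Z_def)
      have "(\<lambda>N. mc_energy J h \<epsilon> \<rho> N F - mc_expect m \<rho> N F) \<in> O(\<lambda>N. mc_Z m' \<rho> N / mc_Z m \<rho> N)"
        by (rule bigoI[of _ "C + C'"], rule eventually_mono[OF eventually_ge_at_top[of N0]])
           (simp only: real_norm_def bound)
      from landau_o.big_trans[OF this mc_Z_ratio_bigo[OF mm'[OF 1(1)] 1(2)]] show ?thesis .
    next
      case 2
      note lt = abs_less[OF 2(1)] mm'[OF 2(1)]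
      have "min (m\<^sup>2) (m'\<^sup>2) = m\<^sup>2" "max (m\<^sup>2) (m'\<^sup>2) = m'\<^sup>2" 
        "min (m'\<^sup>2) (m\<^sup>2) = m\<^sup>2" "max (m'\<^sup>2) (m\<^sup>2) = m'\<^sup>2" "\<not> m'\<^sup>2 < \<rho>" "\<not> \<bar>m'\<bar> \<le> \<bar>m\<bar>" "\<bar>m\<bar> \<le> \<bar>m'\<bar>"
        using lt 2(2) by auto
      moreover have "\<epsilon> < h\<^sup>2 / (2 * J)" using 2(1) s_pos by simp
      ultimately have "mc_energy J h \<epsilon> \<rho> N F = mc_expect m \<rho> N F" for N
        unfolding mc_energy_def Let_def pm using m\<rho> 2(2) by (cases "h > 0") simp_all
      thus ?thesis by simp
    next
      case 3
      have "\<epsilon> = h\<^sup>2 / (2 * J)" using 3 s_pos eps by linarith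
      moreover have m: "m = - h / J" using 3 by (simp add: m_def)
      moreover have "\<rho> > h\<^sup>2 / J\<^sup>2" using m\<rho> by (simp add: m power_divide)
      ultimately have "mc_energy J h \<epsilon> \<rho> N F = mc_expect m \<rho> N F" for N
        unfolding mc_energy_def Let_def by simp
      thus ?thesis by simp
    qed
  qed
  have "(\<lambda>N. mc_energy J h \<epsilon> \<rho> N F - gc_expect (- m / (\<rho> - m\<^sup>2)) (1 / (2 * (\<rho> - m\<^sup>2))) N F)
      \<in> O(\<lambda>N. 1 / sqrt (real N))"
    using sum_in_bigo(1)[OF energy close] by (simp only: add_diff_eq diff_add_cancel)
  thus ?thesis unfolding Let_def F_def m_def s_def .
qed

end
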